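(* Let $w,y>0$ and let $(A,B)=(A',A'B')$, where $(A',B')\sim\beta(w+y,y)\otimes\beta(y,w)$. Set $a=b=w+y$. Then all of the following hold. (i) For $V_2\sim\Gamma_b$, $V_1\sim\Gamma_a$ is the unique (in distribution) solution to $V_1\overset{d}{=}AV_1+BV_2$, where $V_1,V_2,(A,B)$ are mutually independent. (ii) $X\sim\beta(a,b)$ is the unique (in distribution) solution to $X\overset{d}{=}AX+B(1-X)$, where $X$ is independent of $(A,B)$. (iii) There is a random variable $Y\sim\beta(a,b)$ such that, as $n\to\infty$, $Y_n(x)\to Y$ almost surely, uniformly in $x\in[0,1]$. (iv) For every $x\in[0,1]$, $X_n(x)$ converges in distribution to $\beta(a,b)$ as $n\to\infty$. (v) For every $x'\in(0,\infty)$, $X'_n(x')$ converges in distribution to $\Gamma_a$ as $n\to\infty$.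
   Context: $\overset{d}{=}$ denotes equality in distribution. $\beta(a,b)$, $a,b>0$, is the beta distribution with density $B(a,b)^{-1}u^{a-1}(1-u)^{b-1}$ on $(0,1)$. $\Gamma_a$, $a>0$, is the gamma distribution with shape $a$ and scale $1$. $F_1\otimes F_2$ denotes the joint law of independent random elements with laws $F_1$, $F_2$. A solution of a random equation is a real random variable (or its law) satisfying it; uniqueness is in distribution. Let $\mu$ be the law of $(A,B)$ and let $(A_1,B_1,V_1),(A_2,B_2,V_2),\dots$ be i.i.d. with law $\mu\otimes\Gamma_b$. Put $F_n(x)=A_nx+B_n(1-x)$ for $x\in[0,1]$ and $G_n(x')=A_nx'+B_nV_n$ for $x'\in(0,\infty)$. Define, for $n\ge1$, $X_n=F_n\circ F_{n-1}\circ\cdots\circ F_1$ (forward iteration), $Y_n=F_1\circ F_2\circ\cdots\circ F_n$ (backward iteration), and $X'_n=G_n\circ G_{n-1}\circ\cdots\circ G_1$. *)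

theory Defs
  imports "HOL-Probability.Probability"
begin

definition beta_law :: "real \<Rightarrow> real \<Rightarrow> real measure" where
  "beta_law a b = density lborel
     (\<lambda>u. ennreal (if 0 < u \<and> u < 1 then u powr (a - 1) * (1 - u) powr (b - 1) / Beta a b else 0))"

definition gamma_law :: "real \<Rightarrow> real measure" where
  "gamma_law a = density lborel
     (\<lambda>u. ennreal (if 0 < u then u powr (a - 1) * exp (- u) / Gamma a else 0))"

lemma prob_space_beta_law:
  assumes "a > 0" "b > 0"
  shows "prob_space (beta_law a b)"
proof -
  have pos: "Beta a b > 0"
    using assms by (simp add: Beta_def)
  have "((\<lambda>t. t powr (a - 1) * (1 - t) powr (b - 1) / Beta a b) has_integral 1) {0..1}"
    using has_integral_divide[OF has_integral_Beta_real[OF assms], of "Beta a b"] pos by simp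
  then have "((\<lambda>u. if 0 < u \<and> u < 1 then u powr (a - 1) * (1 - u) powr (b - 1) / Beta a b else 0)
      has_integral 1) {0..1}"
    by (rule has_integral_spike[where S = "{0, 1}", rotated 2]) auto
  then have "((\<lambda>u. if 0 < u \<and> u < 1 then u powr (a - 1) * (1 - u) powr (b - 1) / Beta a b else 0)
      has_integral 1) UNIV"
    by (rule has_integral_on_superset) auto
  from nn_integral_has_integral_lborel[OF _ _ this] pos show ?thesis
    by (intro prob_spaceI) (simp add: beta_law_def emeasure_density)
qed

lemma prob_space_gamma_law:
  assumes "a > 0"
  shows "prob_space (gamma_law a)"
proof -
  have pos: "Gamma a > 0"
    using assms by (rule Gamma_real_pos)
  have "((\<lambda>t. t powr (a - 1) * exp (- t) / Gamma a) has_integral 1) {0..}"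
    using has_integral_divide[OF Gamma_integral_real[OF assms], of "Gamma a"] pos
    by (simp add: exp_minus field_simps)
  then have "((\<lambda>u. if 0 < u then u powr (a - 1) * exp (- u) / Gamma a else 0) has_integral 1) {0..}"
    by (rule has_integral_spike[where S = "{0}", rotated 2]) auto
  then have "((\<lambda>u. if 0 < u then u powr (a - 1) * exp (- u) / Gamma a else 0) has_integral 1) UNIV"
    by (rule has_integral_on_superset) auto
  from nn_integral_has_integral_lborel[OF _ _ this] pos show ?thesis
    by (intro prob_spaceI) (simp add: gamma_law_def emeasure_density)
qed

text \<open>The law of \<open>(A, B) = (A', A' B')\<close> with \<open>(A', B')\<close> distributed as the product of
  \<open>beta_law (w + y) y\<close> and \<open>beta_law y w\<close>.\<close>

definition AB_law :: "real \<Rightarrow> real \<Rightarrow> (real \<times> real) measure" where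
  "AB_law w y = distr (beta_law (w + y) y \<Otimes>\<^sub>M beta_law y w) borel (\<lambda>(a', b'). (a', a' * b'))"

text \<open>\<open>\<nu>\<close> is the law of a real random variable \<open>X\<close> that has the same distribution as
  \<open>\<Phi> C X\<close>, where \<open>C\<close> has law \<open>N\<close> and is independent of \<open>X\<close>.  The lemma
  \<open>solves_random_eq_iff\<close> below is the same in terms of random variables.\<close>

definition solves_random_eq ::
    "('c \<Rightarrow> real \<Rightarrow> real) \<Rightarrow> 'c measure \<Rightarrow> real measure \<Rightarrow> bool" where
  "solves_random_eq \<Phi> N \<nu> \<longleftrightarrow>
     prob_space \<nu> \<and> sets \<nu> = sets borel \<and> distr (\<nu> \<Otimes>\<^sub>M N) borel (\<lambda>(x, c). \<Phi> c x) = \<nu>"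

lemma (in prob_space) solves_random_eq_iff:
  assumes X: "X \<in> borel_measurable M" and C: "C \<in> measurable M N'"
    and indep: "distr M (borel \<Otimes>\<^sub>M N') (\<lambda>\<omega>. (X \<omega>, C \<omega>)) = distr M borel X \<Otimes>\<^sub>M distr M N' C"
    and meas: "(\<lambda>(x, c). \<Phi> c x) \<in> borel_measurable (borel \<Otimes>\<^sub>M N')"
  shows "solves_random_eq \<Phi> (distr M N' C) (distr M borel X) \<longleftrightarrow>
    distr M borel X = distr M borel (\<lambda>\<omega>. \<Phi> (C \<omega>) (X \<omega>))"
proof -
  have "distr (distr M borel X \<Otimes>\<^sub>M distr M N' C) borel (\<lambda>(x, c). \<Phi> c x)
      = distr (distr M (borel \<Otimes>\<^sub>M N') (\<lambda>\<omega>. (X \<omega>, C \<omega>))) borel (\<lambda>(x, c). \<Phi> c x)"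
    using indep by simp
  also have "\<dots> = distr M borel (\<lambda>\<omega>. \<Phi> (C \<omega>) (X \<omega>))"
    using X C meas by (subst distr_distr) (auto simp: comp_def)
  finally show ?thesis
    using prob_space_distr[OF X] by (auto simp: solves_random_eq_def)
qed

definition unique_solution ::
    "('c \<Rightarrow> real \<Rightarrow> real) \<Rightarrow> 'c measure \<Rightarrow> real measure \<Rightarrow> bool" where
  "unique_solution \<Phi> N \<nu> \<longleftrightarrow>
     solves_random_eq \<Phi> N \<nu> \<and> (\<forall>\<nu>'. solves_random_eq \<Phi> N \<nu>' \<longrightarrow> \<nu>' = \<nu>)"

definition iid_with_law :: "'a measure \<Rightarrow> ('i \<Rightarrow> 'a \<Rightarrow> 'b::topological_space) \<Rightarrow> 'i set \<Rightarrow> 'b measure \<Rightarrow> bool" where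
  "iid_with_law M Z I N \<longleftrightarrow> prob_space M \<and> prob_space.indep_vars M (\<lambda>_. borel) Z I \<and>
     (\<forall>i\<in>I. distr M borel (Z i) = N)"

text \<open>Only the maps \<open>f 1, f 2, \<dots>\<close> are used; \<open>f 0\<close> plays no role.\<close>

primrec forward_iter :: "(nat \<Rightarrow> 'x \<Rightarrow> 'x) \<Rightarrow> nat \<Rightarrow> 'x \<Rightarrow> 'x" where
  "forward_iter f 0 = id"
| "forward_iter f (Suc n) = f (Suc n) \<circ> forward_iter f n"

primrec backward_iter :: "(nat \<Rightarrow> 'x \<Rightarrow> 'x) \<Rightarrow> nat \<Rightarrow> 'x \<Rightarrow> 'x" where
  "backward_iter f 0 = id"
| "backward_iter f (Suc n) = backward_iter f n \<circ> f (Suc n)"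

end

(*
The fixed point equations are instances of beta-gamma algebra: beta(p,q) times Gamma_(p+q) is Gamma_p,
independent Gamma_p and Gamma_q add up to Gamma_(p+q), and beta(p,q) times beta(p+q,r) is
beta(p,q+r). Indeed A V1 + B V2 = A' (V1 + B' V2), and A X + B (1 - X) = A' (1 - (1 - B') (1 - X)).

Both random maps are affine, x |-> P x + Q with 0 < P < 1 almost surely, so the characteristic
functions f, g of the laws of two random points satisfy |f - g|(t) <= E |f0 - g0|(t P) after one step,
where f0, g0 belong to the points before it. This gives uniqueness of the solution and, the
solutions having finite mean, convergence in law of the iterates at the rate (E P)^n. The backward
iterations map [0,1] onto nested intervals whose length, a product of i.i.d. factors in (0,1), tends
to 0 almost surely; the limit has the law of the forward limit because X_n(x) and Y_n(x)
are equal in law.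
*)

theory Submission
  imports Defs
begin

section \<open>Beta-gamma algebra\<close>

text \<open>Real-valued versions of the densities, so that the algebra on them is done in the reals
  before passing to \<open>ennreal\<close>.\<close>

definition gamma_density :: "real \<Rightarrow> real \<Rightarrow> real" where
  "gamma_density a u = (if 0 < u then u powr (a - 1) * exp (- u) / Gamma a else 0)"

definition beta_density :: "real \<Rightarrow> real \<Rightarrow> real \<Rightarrow> real" where
  "beta_density a b u = (if 0 < u \<and> u < 1 then u powr (a - 1) * (1 - u) powr (b - 1) / Beta a b else 0)"

lemma gamma_law_eq_density: "gamma_law a = density lborel (\<lambda>u. ennreal (gamma_density a u))"
  by (simp add: gamma_law_def gamma_density_def)

lemma beta_law_eq_density: "beta_law a b = density lborel (\<lambda>u. ennreal (beta_density a b u))"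
  by (simp add: beta_law_def beta_density_def)

lemma gamma_density_measurable [measurable]: "gamma_density a \<in> borel_measurable borel"
  unfolding gamma_density_def by measurable

lemma beta_density_measurable [measurable]: "beta_density a b \<in> borel_measurable borel"
  unfolding beta_density_def by measurable

lemma gamma_density_nonneg: "a > 0 \<Longrightarrow> gamma_density a u \<ge> 0"
  by (simp add: gamma_density_def Gamma_real_nonneg)

lemma beta_density_nonneg: "a > 0 \<Longrightarrow> b > 0 \<Longrightarrow> beta_density a b u \<ge> 0"
  by (simp add: beta_density_def Beta_def Gamma_real_nonneg)

lemma sets_gamma_law [simp, measurable_cong]: "sets (gamma_law a) = sets borel"
  by (simp add: gamma_law_def)

lemma sets_beta_law [simp, measurable_cong]: "sets (beta_law a b) = sets borel"
  by (simp add: beta_law_def)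

lemma space_gamma_law [simp]: "space (gamma_law a) = UNIV"
  by (simp add: gamma_law_def)

lemma space_beta_law [simp]: "space (beta_law a b) = UNIV"
  by (simp add: beta_law_def)

text \<open>The factor \<open>s\<close> is the Jacobian of the substitution
  \<open>x = s * u\<close>. The two exponentials combine to \<open>exp (- s)\<close>, the powers of
  \<open>s\<close> collect to the exponent \<open>p + q - 1\<close>, and \<open>Beta p q\<close> is
  the quotient of the Gamma constants; hence the variables \<open>s\<close> and \<open>u\<close>
  separate.\<close>

lemma gamma_density_mult_eq:
  assumes "p > 0" "q > 0" "s > 0"
  shows "s * (gamma_density p (s * u) * gamma_density q (s - s * u)) =
    gamma_density (p + q) s * beta_density p q u"
proof (cases "0 < u \<and> u < 1")
  case True
  have *: "s - s * u = s * (1 - u)" by (simp add: algebra_simps)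
  have G: "Gamma p \<noteq> 0" "Gamma q \<noteq> 0" "Gamma (p + q) \<noteq> 0"
    using assms by (metis Gamma_real_pos add_pos_pos less_irrefl)+
  have e: "exp (- (s * u)) * exp (- (s * (1 - u))) = exp (- s)"
    by (simp add: exp_add [symmetric] algebra_simps)
  have s: "s * (s powr (p - 1) * s powr (q - 1)) = s powr (p + q - 1)"
    using assms powr_mult_base[of s "p - 1 + (q - 1)"] by (simp add: powr_add [symmetric] algebra_simps)
  have "s * (gamma_density p (s * u) * gamma_density q (s - s * u)) =
     (s * (s powr (p - 1) * s powr (q - 1))) * (exp (- (s * u)) * exp (- (s * (1 - u)))) *
     (u powr (p - 1) * (1 - u) powr (q - 1)) / (Gamma p * Gamma q)"
    unfolding * using True assms by (simp add: gamma_density_def powr_mult)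
  also have "\<dots> = gamma_density (p + q) s * beta_density p q u"
    unfolding e s using True assms G by (simp add: gamma_density_def beta_density_def Beta_def field_simps)
  finally show ?thesis .
next
  case False
  \<comment> \<open>Outside the unit interval one of \<open>s * u\<close> and
    \<open>s - s * u\<close> is not positive, so its gamma density vanishes.\<close>
  then have "gamma_density p (s * u) * gamma_density q (s - s * u) = 0 \<and> beta_density p q u = 0"
    using assms mult_le_cancel_left_pos[of s 1 u]
    by (auto simp: gamma_density_def beta_density_def zero_less_mult_iff not_less)
  then show ?thesis by simp
qed

text \<open>Two independent gamma variables \<open>x, y\<close> are \<open>u s, (1 - u) s\<close> with
  \<open>s = x + y\<close> and \<open>u = x / s\<close> independent: substitute \<open>y = s - x\<close>, exchange the
  integrals, then substitute \<open>x = s u\<close>.\<close>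

lemma nn_integral_gamma_gamma:
  assumes [simp]: "p > 0" "q > 0" and [measurable]: "f \<in> borel_measurable (borel \<Otimes>\<^sub>M borel)"
  shows "(\<integral>\<^sup>+x. \<integral>\<^sup>+y. f (x, y) \<partial>gamma_law q \<partial>gamma_law p) =
    (\<integral>\<^sup>+s. \<integral>\<^sup>+u. f (u * s, (1 - u) * s) \<partial>beta_law p q \<partial>gamma_law (p + q))"
proof -
  have [simp]: "p + q > 0"
    by (simp add: add_pos_pos)
  let ?h = "\<lambda>x s. ennreal (gamma_density p x) * (ennreal (gamma_density q (s - x)) * f (x, s - x))"
  have "(\<integral>\<^sup>+x. \<integral>\<^sup>+y. f (x, y) \<partial>gamma_law q \<partial>gamma_law p) =
    (\<integral>\<^sup>+x. ennreal (gamma_density p x) *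
      (\<integral>\<^sup>+y. ennreal (gamma_density q y) * f (x, y) \<partial>lborel) \<partial>lborel)"
    by (simp add: gamma_law_eq_density nn_integral_density)
  also have "\<dots> = (\<integral>\<^sup>+x. \<integral>\<^sup>+s. ?h x s \<partial>lborel \<partial>lborel)"
  proof (rule nn_integral_cong)
    fix x :: real
    show "ennreal (gamma_density p x) * (\<integral>\<^sup>+y. ennreal (gamma_density q y) * f (x, y) \<partial>lborel) =
      (\<integral>\<^sup>+s. ?h x s \<partial>lborel)"
      by (subst nn_integral_real_affine[where c = 1 and t = "- x"]) (simp_all add: nn_integral_cmult)
  qed
  also have "\<dots> = (\<integral>\<^sup>+s. \<integral>\<^sup>+x. ?h x s \<partial>lborel \<partial>lborel)"
    by (rule lborel_pair.Fubini') measurable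
  also have "\<dots> = (\<integral>\<^sup>+s. ennreal (gamma_density (p + q) s) *
      (\<integral>\<^sup>+u. ennreal (beta_density p q u) * f (u * s, (1 - u) * s) \<partial>lborel) \<partial>lborel)"
  proof (rule nn_integral_cong)
    fix s :: real
    show "(\<integral>\<^sup>+x. ?h x s \<partial>lborel) = ennreal (gamma_density (p + q) s) *
      (\<integral>\<^sup>+u. ennreal (beta_density p q u) * f (u * s, (1 - u) * s) \<partial>lborel)"
    proof (cases "s > 0")
      case True
      have "(\<integral>\<^sup>+x. ?h x s \<partial>lborel) = ennreal s * (\<integral>\<^sup>+u. ?h (s * u) s \<partial>lborel)"
        using True by (subst nn_integral_real_affine[where c = s and t = 0]) simp_all
      also have "\<dots> = (\<integral>\<^sup>+u. ennreal s * ?h (s * u) s \<partial>lborel)"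
        by (simp add: nn_integral_cmult)
      also have "\<dots> = (\<integral>\<^sup>+u. ennreal (gamma_density (p + q) s) *
          (ennreal (beta_density p q u) * f (u * s, (1 - u) * s)) \<partial>lborel)"
      proof (rule nn_integral_cong)
        fix u :: real
        have pair_eq: "(s * u, s - s * u) = (u * s, (1 - u) * s)"
          by (simp add: algebra_simps)
        have "ennreal s * ?h (s * u) s =
          ennreal (s * (gamma_density p (s * u) * gamma_density q (s - s * u))) * f (u * s, (1 - u) * s)"
          unfolding pair_eq using True by (simp add: ennreal_mult gamma_density_nonneg mult.assoc)
        also have "s * (gamma_density p (s * u) * gamma_density q (s - s * u)) =
          gamma_density (p + q) s * beta_density p q u"
          using True by (intro gamma_density_mult_eq) simp_all
        also have "ennreal (gamma_density (p + q) s * beta_density p q u) * f (u * s, (1 - u) * s) =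
          ennreal (gamma_density (p + q) s) * (ennreal (beta_density p q u) * f (u * s, (1 - u) * s))"
          by (simp add: ennreal_mult gamma_density_nonneg beta_density_nonneg mult.assoc)
        finally show "ennreal s * ?h (s * u) s =
          ennreal (gamma_density (p + q) s) * (ennreal (beta_density p q u) * f (u * s, (1 - u) * s))" .
      qed
      finally show ?thesis by (simp add: nn_integral_cmult)
    next
      case False
      \<comment> \<open>For \<open>x > 0\<close> the difference \<open>s - x\<close> is negative,
        and for other \<open>x\<close> the first density is zero.\<close>
      then have "?h x s = 0" for x
        by (cases "x > 0") (auto simp: gamma_density_def)
      then have "(\<integral>\<^sup>+x. ?h x s \<partial>lborel) = 0"
        by (simp only: nn_integral_const mult_zero_left)
      moreover have "gamma_density (p + q) s = 0"
        using False by (simp add: gamma_density_def)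
      ultimately show ?thesis by simp
    qed
  qed
  also have "\<dots> = (\<integral>\<^sup>+s. \<integral>\<^sup>+u. f (u * s, (1 - u) * s) \<partial>beta_law p q \<partial>gamma_law (p + q))"
    by (simp add: gamma_law_eq_density beta_law_eq_density nn_integral_density)
  finally show ?thesis .
qed

lemma AE_gamma_law_pos: "AE x in gamma_law a. x > 0"
  unfolding gamma_law_eq_density by (subst AE_density) (auto simp: gamma_density_def)

lemma AE_beta_law: "AE x in beta_law a b. 0 < x \<and> x < 1"
  unfolding beta_law_eq_density by (subst AE_density) (auto simp: beta_density_def)

text \<open>The density is finite at every point. Sigma-finiteness is what Fubini asks for, and the
  interpretations below supply it for all parameters.\<close>

lemma sigma_finite_gamma_law: "sigma_finite_measure (gamma_law a)"
  unfolding gamma_law_eq_density by (subst sigma_finite_measure.sigma_finite_iff_density_finite[OF sigma_finite_lborel]) auto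

lemma sigma_finite_beta_law: "sigma_finite_measure (beta_law a b)"
  unfolding beta_law_eq_density by (subst sigma_finite_measure.sigma_finite_iff_density_finite[OF sigma_finite_lborel]) auto

interpretation gamma: sigma_finite_measure "gamma_law a" for a
  by (rule sigma_finite_gamma_law)

interpretation beta: sigma_finite_measure "beta_law a b" for a b
  by (rule sigma_finite_beta_law)

lemma nn_integral_const_prob_space:
  fixes M :: "'a measure"
  shows "prob_space M \<Longrightarrow> (\<integral>\<^sup>+x. c \<partial>M) = c"
  by (simp add: prob_space.emeasure_space_1)

text \<open>Independence is handled through iterated integrals throughout; this form of Fubini
  exchanges two neighbouring ones by rewriting.\<close>

lemma nn_integral_commute:
  assumes "sigma_finite_measure M" "sigma_finite_measure N"
    and "case_prod f \<in> borel_measurable (M \<Otimes>\<^sub>M N)"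
  shows "(\<integral>\<^sup>+x. \<integral>\<^sup>+y. f x y \<partial>N \<partial>M) = (\<integral>\<^sup>+y. \<integral>\<^sup>+x. f x y \<partial>M \<partial>N)"
  using pair_sigma_finite.Fubini'[of M N f] assms by (simp add: pair_sigma_finite_def)

text \<open>In the coordinates \<open>s\<close>, \<open>u\<close> of
  \<open>nn_integral_gamma_gamma\<close> the integrand depends on \<open>s\<close> alone, so the
  beta integral contributes the total mass 1.\<close>

lemma nn_integral_gamma_add:
  assumes [simp]: "p > 0" "q > 0" and [measurable]: "f \<in> borel_measurable borel"
  shows "(\<integral>\<^sup>+x. \<integral>\<^sup>+y. f (x + y) \<partial>gamma_law q \<partial>gamma_law p) = (\<integral>\<^sup>+s. f s \<partial>gamma_law (p + q))"
proof -
  have [simp]: "p + q > 0"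
    by (simp add: add_pos_pos)
  show ?thesis
    using nn_integral_gamma_gamma[of p q "\<lambda>(x, y). f (x + y)"]
    by (simp add: algebra_simps nn_integral_const_prob_space prob_space_beta_law del: nn_integral_const)
qed

text \<open>Apply \<open>nn_integral_gamma_gamma\<close> to a function of the first coordinate only;
  the second gamma variable integrates out.\<close>

lemma nn_integral_beta_gamma_mult:
  assumes [simp]: "p > 0" "q > 0" and [measurable]: "f \<in> borel_measurable borel"
  shows "(\<integral>\<^sup>+s. \<integral>\<^sup>+u. f (u * s) \<partial>beta_law p q \<partial>gamma_law (p + q)) = (\<integral>\<^sup>+x. f x \<partial>gamma_law p)"
proof -
  have [simp]: "p + q > 0"
    by (simp add: add_pos_pos)
  show ?thesis
    using nn_integral_gamma_gamma[of p q "\<lambda>(x, y). f x"]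
    by (simp add: nn_integral_const_prob_space prob_space_gamma_law del: nn_integral_const)
qed

text \<open>The ratio \<open>x / (x + y)\<close> is the coordinate \<open>u\<close> whenever
  \<open>s > 0\<close>, which holds almost surely; then \<open>s\<close> integrates out. This
  represents a beta variable by two independent gamma variables.\<close>

lemma nn_integral_beta_eq_ratio:
  assumes [simp]: "p > 0" "q > 0" and [measurable]: "f \<in> borel_measurable borel"
  shows "(\<integral>\<^sup>+u. f u \<partial>beta_law p q) = (\<integral>\<^sup>+x. \<integral>\<^sup>+y. f (x / (x + y)) \<partial>gamma_law q \<partial>gamma_law p)"
proof -
  have [simp]: "p + q > 0"
    by (simp add: add_pos_pos)
  have "(\<integral>\<^sup>+x. \<integral>\<^sup>+y. f (x / (x + y)) \<partial>gamma_law q \<partial>gamma_law p) =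
     (\<integral>\<^sup>+s. \<integral>\<^sup>+u. f (u * s / (u * s + (1 - u) * s)) \<partial>beta_law p q \<partial>gamma_law (p + q))"
    using nn_integral_gamma_gamma[of p q "\<lambda>(x, y). f (x / (x + y))"] by simp
  also have "\<dots> = (\<integral>\<^sup>+s. \<integral>\<^sup>+u. f u \<partial>beta_law p q \<partial>gamma_law (p + q))"
  proof (rule nn_integral_cong_AE)
    have *: "u * s / (u * s + (1 - u) * s) = u" if "s > 0" for u s :: real
    proof -
      have "u * s + (1 - u) * s = s" by (simp add: algebra_simps)
      then show ?thesis using that by simp
    qed
    show "AE s in gamma_law (p + q). (\<integral>\<^sup>+u. f (u * s / (u * s + (1 - u) * s)) \<partial>beta_law p q) =
        (\<integral>\<^sup>+u. f u \<partial>beta_law p q)"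
      using AE_gamma_law_pos by eventually_elim (simp only: *)
  qed
  also have "\<dots> = (\<integral>\<^sup>+u. f u \<partial>beta_law p q)"
    by (simp add: nn_integral_const_prob_space prob_space_gamma_law del: nn_integral_const)
  finally show ?thesis by simp
qed

text \<open>Substituting \<open>1 - u\<close> for \<open>u\<close> exchanges the two exponents of
  the beta density, and \<open>Beta\<close> is symmetric.\<close>

lemma nn_integral_beta_reflect:
  assumes [measurable]: "f \<in> borel_measurable borel"
  shows "(\<integral>\<^sup>+u. f (1 - u) \<partial>beta_law p q) = (\<integral>\<^sup>+u. f u \<partial>beta_law q p)"
proof -
  have *: "beta_density p q (1 - u) = beta_density q p u" for u
    by (auto simp: beta_density_def Beta_commute)
  have "(\<integral>\<^sup>+u. f (1 - u) \<partial>beta_law p q) = (\<integral>\<^sup>+u. beta_density p q u * f (1 - u) \<partial>lborel)"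
    by (simp add: beta_law_eq_density nn_integral_density)
  also have "\<dots> = (\<integral>\<^sup>+u. beta_density p q (1 - u) * f u \<partial>lborel)"
    by (subst nn_integral_real_affine[where c = "-1" and t = 1]) simp_all
  also have "\<dots> = (\<integral>\<^sup>+u. f u \<partial>beta_law q p)"
    by (simp add: * beta_law_eq_density nn_integral_density)
  finally show ?thesis .
qed

text \<open>Write \<open>v\<close> as \<open>s / (s + z)\<close> with independent gamma variables of
  shapes \<open>p + q\<close> and \<open>r\<close>. Then \<open>x = u * s\<close> and
  \<open>y = (1 - u) * s\<close> are independent gamma variables of shapes \<open>p\<close> and
  \<open>q\<close>, and \<open>u * v\<close> equals \<open>x / (x + y + z)\<close>. Since
  \<open>y + z\<close> has shape \<open>q + r\<close>, this ratio is again beta.\<close>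

lemma nn_integral_beta_beta_mult:
  assumes [simp]: "p > 0" "q > 0" "r > 0" and [measurable]: "f \<in> borel_measurable borel"
  shows "(\<integral>\<^sup>+u. \<integral>\<^sup>+v. f (u * v) \<partial>beta_law (p + q) r \<partial>beta_law p q) = (\<integral>\<^sup>+u. f u \<partial>beta_law p (q + r))"
proof -
  have [simp]: "p + q > 0"
    by (simp add: add_pos_pos)
  have [simp]: "q + r > 0"
    by (simp add: add_pos_pos)
  have "(\<integral>\<^sup>+u. \<integral>\<^sup>+v. f (u * v) \<partial>beta_law (p + q) r \<partial>beta_law p q) =
    (\<integral>\<^sup>+u. \<integral>\<^sup>+s. \<integral>\<^sup>+z. f (u * (s / (s + z))) \<partial>gamma_law r \<partial>gamma_law (p + q) \<partial>beta_law p q)"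
    using nn_integral_beta_eq_ratio[of "p + q" r "\<lambda>v. f (u * v)" for u] by simp
  also have "\<dots> = (\<integral>\<^sup>+s. \<integral>\<^sup>+u. \<integral>\<^sup>+z. f (u * s / (u * s + (1 - u) * s + z)) \<partial>gamma_law r
      \<partial>beta_law p q \<partial>gamma_law (p + q))"
    by (subst nn_integral_commute) (simp_all add: sigma_finite_gamma_law sigma_finite_beta_law algebra_simps)
  also have "\<dots> = (\<integral>\<^sup>+x. \<integral>\<^sup>+y. \<integral>\<^sup>+z. f (x / (x + y + z)) \<partial>gamma_law r \<partial>gamma_law q \<partial>gamma_law p)"
    using nn_integral_gamma_gamma[of p q "\<lambda>(x, y). \<integral>\<^sup>+z. f (x / (x + y + z)) \<partial>gamma_law r"] by simp
  also have "\<dots> = (\<integral>\<^sup>+x. \<integral>\<^sup>+s. f (x / (x + s)) \<partial>gamma_law (q + r) \<partial>gamma_law p)"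
    using nn_integral_gamma_add[of q r "\<lambda>s. f (x / (x + s))" for x] by (simp add: add.assoc)
  also have "\<dots> = (\<integral>\<^sup>+u. f u \<partial>beta_law p (q + r))"
    by (simp add: nn_integral_beta_eq_ratio)
  finally show ?thesis .
qed

section \<open>The two fixed points\<close>

lemma borel_measure_eqI_nn_integral:
  assumes "sets M = sets borel" "sets N = sets borel"
    and "\<And>f. f \<in> borel_measurable borel \<Longrightarrow> (\<integral>\<^sup>+x. f x \<partial>M) = (\<integral>\<^sup>+x. f x \<partial>N)"
  shows "M = N"
proof (rule measure_eqI)
  fix X assume "X \<in> sets M"
  then show "emeasure M X = emeasure N X"
    using assms(3)[of "indicator X"] assms(1,2) by simp
qed (simp add: assms)

text \<open>\<open>AB_law\<close> is built on the Borel sets of the product type; Fubini needs them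
  as a product sigma-algebra, which \<open>borel_prod\<close> provides.\<close>

lemma sets_AB_law [simp, measurable_cong]: "sets (AB_law w y) = sets (borel \<Otimes>\<^sub>M borel)"
  by (simp add: AB_law_def borel_prod [symmetric])

lemma prob_space_AB_law:
  assumes "w > 0" "y > 0"
  shows "prob_space (AB_law w y)"
proof -
  interpret A': prob_space "beta_law (w + y) y" using assms by (intro prob_space_beta_law) auto
  interpret B': prob_space "beta_law y w" using assms by (intro prob_space_beta_law) auto
  interpret pair_prob_space "beta_law (w + y) y" "beta_law y w" ..
  show ?thesis
    unfolding AB_law_def by (rule P.prob_space_distr) (simp add: borel_prod [symmetric])
qed

lemma nn_integral_AB_law:
  assumes [measurable]: "f \<in> borel_measurable (borel \<Otimes>\<^sub>M borel)"
  shows "(\<integral>\<^sup>+c. f c \<partial>AB_law w y) = (\<integral>\<^sup>+a. \<integral>\<^sup>+b. f (a, a * b) \<partial>beta_law y w \<partial>beta_law (w + y) y)"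
  unfolding AB_law_def
  by (subst nn_integral_distr)
     (simp_all add: borel_prod [symmetric] beta.nn_integral_fst [symmetric] case_prod_beta)

text \<open>Three reductions: \<open>b * v\<close> is gamma of shape \<open>y\<close>, adding
  \<open>x\<close> raises the shape to \<open>w + y + y\<close>, and multiplying by \<open>a\<close>
  with law \<open>beta_law (w + y) y\<close> brings it back to \<open>w + y\<close>.\<close>

lemma solves_random_eq_gamma:
  assumes [simp]: "w > 0" "y > 0"
  shows "solves_random_eq (\<lambda>(v2, (\<alpha>, \<beta>)) v1. \<alpha> * v1 + \<beta> * v2)
    (gamma_law (w + y) \<Otimes>\<^sub>M AB_law w y) (gamma_law (w + y))"
proof -
  have [simp]: "w + y > 0"
    by (simp add: add_pos_pos)
  let ?N = "gamma_law (w + y) \<Otimes>\<^sub>M AB_law w y" and ?\<Phi> = "\<lambda>(v2, (\<alpha>, \<beta>)) v1. \<alpha> * v1 + \<beta> * v2 :: real"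
  interpret AB: prob_space "AB_law w y" by (simp add: prob_space_AB_law)
  interpret g: prob_space "gamma_law (w + y)" by (simp add: prob_space_gamma_law)
  interpret N: pair_prob_space "gamma_law (w + y)" "AB_law w y" ..
  have [measurable]: "(\<lambda>(x, c). ?\<Phi> c x) \<in> borel_measurable (borel \<Otimes>\<^sub>M (borel \<Otimes>\<^sub>M (borel \<Otimes>\<^sub>M borel)))"
    by (simp add: case_prod_beta)
  have "distr (gamma_law (w + y) \<Otimes>\<^sub>M ?N) borel (\<lambda>(x, c). ?\<Phi> c x) = gamma_law (w + y)"
  proof (rule borel_measure_eqI_nn_integral)
    fix f :: "real \<Rightarrow> ennreal" assume [measurable]: "f \<in> borel_measurable borel"
    have "(\<integral>\<^sup>+x. f x \<partial>distr (gamma_law (w + y) \<Otimes>\<^sub>M ?N) borel (\<lambda>(x, c). ?\<Phi> c x)) =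
      (\<integral>\<^sup>+x. \<integral>\<^sup>+v. \<integral>\<^sup>+c. f (fst c * x + snd c * v) \<partial>AB_law w y \<partial>gamma_law (w + y) \<partial>gamma_law (w + y))"
      by (subst nn_integral_distr)
        (simp_all add: borel_prod [symmetric] N.nn_integral_fst [symmetric] AB.nn_integral_fst [symmetric] case_prod_beta)
    also have "\<dots> = (\<integral>\<^sup>+x. \<integral>\<^sup>+v. \<integral>\<^sup>+a. \<integral>\<^sup>+b. f (a * x + a * b * v)
        \<partial>beta_law y w \<partial>beta_law (w + y) y \<partial>gamma_law (w + y) \<partial>gamma_law (w + y))"
      by (subst nn_integral_AB_law) simp_all
    \<comment> \<open>The shape of \<open>v\<close> is rewritten as \<open>y + w\<close> to fit the
      product rule for \<open>beta_law y w\<close>.\<close>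
    also have "\<dots> = (\<integral>\<^sup>+x. \<integral>\<^sup>+a. \<integral>\<^sup>+v. \<integral>\<^sup>+b. f (a * (x + b * v))
        \<partial>beta_law y w \<partial>gamma_law (y + w) \<partial>beta_law (w + y) y \<partial>gamma_law (w + y))"
      by (subst (1) nn_integral_commute)
         (simp_all add: sigma_finite_gamma_law sigma_finite_beta_law algebra_simps)
    also have "\<dots> = (\<integral>\<^sup>+x. \<integral>\<^sup>+a. \<integral>\<^sup>+z. f (a * (x + z))
        \<partial>gamma_law y \<partial>beta_law (w + y) y \<partial>gamma_law (w + y))"
      using nn_integral_beta_gamma_mult[of y w "\<lambda>z. f (a * (x + z))" for a x] by simp
    also have "\<dots> = (\<integral>\<^sup>+x. \<integral>\<^sup>+z. \<integral>\<^sup>+a. f (a * (x + z))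
        \<partial>beta_law (w + y) y \<partial>gamma_law y \<partial>gamma_law (w + y))"
      by (subst (1) nn_integral_commute) (simp_all add: sigma_finite_gamma_law sigma_finite_beta_law)
    also have "\<dots> = (\<integral>\<^sup>+s. \<integral>\<^sup>+a. f (a * s) \<partial>beta_law (w + y) y \<partial>gamma_law (w + y + y))"
      using nn_integral_gamma_add[of "w + y" y "\<lambda>s. \<integral>\<^sup>+a. f (a * s) \<partial>beta_law (w + y) y"]
      by simp
    also have "\<dots> = (\<integral>\<^sup>+x. f x \<partial>gamma_law (w + y))"
      using nn_integral_beta_gamma_mult[of "w + y" y f] by simp
    finally show "(\<integral>\<^sup>+x. f x \<partial>distr (gamma_law (w + y) \<Otimes>\<^sub>M ?N) borel (\<lambda>(x, c). ?\<Phi> c x)) =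
      (\<integral>\<^sup>+x. f x \<partial>gamma_law (w + y))" .
  qed simp_all
  then show ?thesis
    by (simp add: solves_random_eq_def g.prob_space_axioms)
qed

text \<open>Both \<open>1 - b\<close> and \<open>1 - x\<close> are beta by reflection, with
  parameters \<open>w, y\<close> and \<open>w + y, w + y\<close>; their product is beta with
  \<open>w, w + y + y\<close>. Reflecting once more and multiplying by \<open>a\<close>, with
  parameters \<open>w + y, y\<close>, returns the initial law.\<close>

lemma solves_random_eq_beta:
  assumes [simp]: "w > 0" "y > 0"
  shows "solves_random_eq (\<lambda>(\<alpha>, \<beta>) x. \<alpha> * x + \<beta> * (1 - x)) (AB_law w y) (beta_law (w + y) (w + y))"
proof -
  have [simp]: "w + y > 0"
    by (simp add: add_pos_pos)
  have [simp]: "w + y + y > 0"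
    by (simp add: add_pos_pos)
  let ?\<Phi> = "\<lambda>(\<alpha>, \<beta>) x. \<alpha> * x + \<beta> * (1 - x) :: real"
  interpret AB: prob_space "AB_law w y" by (simp add: prob_space_AB_law)
  have [measurable]: "(\<lambda>(x, c). ?\<Phi> c x) \<in> borel_measurable (borel \<Otimes>\<^sub>M (borel \<Otimes>\<^sub>M borel))"
    by (simp add: case_prod_beta)
  have "distr (beta_law (w + y) (w + y) \<Otimes>\<^sub>M AB_law w y) borel (\<lambda>(x, c). ?\<Phi> c x) = beta_law (w + y) (w + y)"
  proof (rule borel_measure_eqI_nn_integral)
    fix f :: "real \<Rightarrow> ennreal" assume [measurable]: "f \<in> borel_measurable borel"
    \<comment> \<open>Averaging over \<open>a\<close> first leaves a function of one variable, so
      that the reflections and the first product rule never meet \<open>a\<close>.\<close>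
    define g where "g z = (\<integral>\<^sup>+a. f (a * z) \<partial>beta_law (w + y) y)" for z
    have [measurable]: "g \<in> borel_measurable borel"
      unfolding g_def by measurable
    have "(\<integral>\<^sup>+x. f x \<partial>distr (beta_law (w + y) (w + y) \<Otimes>\<^sub>M AB_law w y) borel (\<lambda>(x, c). ?\<Phi> c x)) =
      (\<integral>\<^sup>+x. \<integral>\<^sup>+c. f (fst c * x + snd c * (1 - x)) \<partial>AB_law w y \<partial>beta_law (w + y) (w + y))"
      by (subst nn_integral_distr)
        (simp_all add: borel_prod [symmetric] AB.nn_integral_fst [symmetric] case_prod_beta)
    also have "\<dots> = (\<integral>\<^sup>+x. \<integral>\<^sup>+a. \<integral>\<^sup>+b. f (a * (1 - (1 - b) * (1 - x)))
        \<partial>beta_law y w \<partial>beta_law (w + y) y \<partial>beta_law (w + y) (w + y))"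
      by (subst nn_integral_AB_law) (simp_all add: algebra_simps)
    also have "\<dots> = (\<integral>\<^sup>+x. \<integral>\<^sup>+b. g (1 - (1 - b) * (1 - x)) \<partial>beta_law y w \<partial>beta_law (w + y) (w + y))"
      unfolding g_def by (subst (1) nn_integral_commute) (simp_all add: sigma_finite_beta_law)
    also have "\<dots> = (\<integral>\<^sup>+x. \<integral>\<^sup>+b. g (1 - b * (1 - x)) \<partial>beta_law w y \<partial>beta_law (w + y) (w + y))"
      using nn_integral_beta_reflect[of "\<lambda>b. g (1 - b * (1 - x))" for x] by simp
    also have "\<dots> = (\<integral>\<^sup>+x. \<integral>\<^sup>+b. g (1 - b * x) \<partial>beta_law w y \<partial>beta_law (w + y) (w + y))"
      using nn_integral_beta_reflect[of "\<lambda>x. \<integral>\<^sup>+b. g (1 - b * x) \<partial>beta_law w y"] by simp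
    also have "\<dots> = (\<integral>\<^sup>+b. \<integral>\<^sup>+x. g (1 - b * x) \<partial>beta_law (w + y) (w + y) \<partial>beta_law w y)"
      by (subst nn_integral_commute) (simp_all add: sigma_finite_beta_law)
    also have "\<dots> = (\<integral>\<^sup>+v. g (1 - v) \<partial>beta_law w (w + y + y))"
      using nn_integral_beta_beta_mult[of w y "w + y" "\<lambda>v. g (1 - v)"] by (simp add: ac_simps)
    also have "\<dots> = (\<integral>\<^sup>+v. g v \<partial>beta_law (w + y + y) w)"
      by (simp add: nn_integral_beta_reflect)
    also have "\<dots> = (\<integral>\<^sup>+a. \<integral>\<^sup>+v. f (a * v) \<partial>beta_law (w + y + y) w \<partial>beta_law (w + y) y)"
      unfolding g_def by (subst nn_integral_commute) (simp_all add: sigma_finite_beta_law)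
    also have "\<dots> = (\<integral>\<^sup>+x. f x \<partial>beta_law (w + y) (w + y))"
      using nn_integral_beta_beta_mult[of "w + y" y w f] by (simp add: ac_simps)
    finally show "(\<integral>\<^sup>+x. f x \<partial>distr (beta_law (w + y) (w + y) \<Otimes>\<^sub>M AB_law w y) borel (\<lambda>(x, c). ?\<Phi> c x)) =
      (\<integral>\<^sup>+x. f x \<partial>beta_law (w + y) (w + y))" .
  qed simp_all
  then show ?thesis
    by (simp add: solves_random_eq_def prob_space_beta_law)
qed

section \<open>Affine random equations\<close>

lemma real_distribution_iff: "real_distribution \<nu> \<longleftrightarrow> prob_space \<nu> \<and> sets \<nu> = sets borel"
  by (simp add: real_distribution_def real_distribution_axioms_def)

text \<open>One step as an operator on laws: solutions are its fixed points, and its powers at a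
  point mass are the laws of the iterates.\<close>

definition random_step :: "('c \<Rightarrow> real \<Rightarrow> real) \<Rightarrow> 'c measure \<Rightarrow> real measure \<Rightarrow> real measure" where
  "random_step \<Phi> N \<nu> = distr (\<nu> \<Otimes>\<^sub>M N) borel (\<lambda>(x, c). \<Phi> c x)"

lemma solves_random_eq_iff_fixpoint:
  "solves_random_eq \<Phi> N \<nu> \<longleftrightarrow> real_distribution \<nu> \<and> random_step \<Phi> N \<nu> = \<nu>"
  by (auto simp: solves_random_eq_def random_step_def real_distribution_iff)

text \<open>Common frame of both recursions. The slope and intercept are \<open>A\<close> and
  \<open>B * V\<close> in the gamma case, \<open>A - B\<close> and \<open>B\<close> in the beta
  case.\<close>

locale affine_recursion = N: prob_space N for N :: "'c measure" +
  fixes P Q :: "'c \<Rightarrow> real" and \<Phi> :: "'c \<Rightarrow> real \<Rightarrow> real"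
  assumes measurable_P [measurable]: "P \<in> borel_measurable N"
    and measurable_Q [measurable]: "Q \<in> borel_measurable N"
    and \<Phi>_eq: "\<Phi> c x = P c * x + Q c"
    and AE_P: "AE c in N. 0 < P c \<and> P c < 1"
begin

lemma measurable_\<Phi> [measurable]: "(\<lambda>(x, c). \<Phi> c x) \<in> borel_measurable (borel \<Otimes>\<^sub>M N)"
  unfolding \<Phi>_eq by measurable

lemma real_distribution_random_step:
  assumes "real_distribution \<nu>"
  shows "real_distribution (random_step \<Phi> N \<nu>)"
proof -
  interpret \<nu>: real_distribution \<nu> by fact
  interpret pair_prob_space \<nu> N ..
  show ?thesis
    unfolding random_step_def by (rule P.real_distribution_distr) measurable
qed

text \<open>Condition on the coefficients: for fixed \<open>c\<close> the affine map contributes a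
  phase and rescales the argument of the characteristic function by \<open>P c\<close>.\<close>

lemma char_random_step:
  assumes "real_distribution \<nu>"
  shows "char (random_step \<Phi> N \<nu>) t = (\<integral>c. iexp (t * Q c) * char \<nu> (t * P c) \<partial>N)"
proof -
  interpret \<nu>: real_distribution \<nu> by fact
  interpret pair_prob_space \<nu> N ..
  have int: "integrable (\<nu> \<Otimes>\<^sub>M N) (\<lambda>(x, c). iexp (t * (P c * x + Q c)))"
    by (rule P.integrable_const_bound[where B = 1]) (auto simp: case_prod_beta)
  have "char (random_step \<Phi> N \<nu>) t = (\<integral>z. (case z of (x, c) \<Rightarrow> iexp (t * (P c * x + Q c))) \<partial>(\<nu> \<Otimes>\<^sub>M N))"
    unfolding random_step_def char_def
    by (subst integral_distr) (auto simp: \<Phi>_eq case_prod_beta intro!: Bochner_Integration.integral_cong)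
  also have "\<dots> = (\<integral>c. \<integral>x. iexp (t * (P c * x + Q c)) \<partial>\<nu> \<partial>N)"
    using integral_snd[OF int] by simp
  also have "\<dots> = (\<integral>c. iexp (t * Q c) * char \<nu> (t * P c) \<partial>N)"
  proof (rule Bochner_Integration.integral_cong[OF refl])
    fix c
    have "(\<integral>x. iexp (t * (P c * x + Q c)) \<partial>\<nu>) = (\<integral>x. iexp (t * Q c) * iexp (t * P c * x) \<partial>\<nu>)"
      by (intro Bochner_Integration.integral_cong refl)
         (simp add: exp_add [symmetric] algebra_simps)
    then show "(\<integral>x. iexp (t * (P c * x + Q c)) \<partial>\<nu>) = iexp (t * Q c) * char \<nu> (t * P c)"
      by (simp add: char_def)
  qed
  finally show ?thesis .
qed

text \<open>The intercept enters only through a factor of modulus 1, so it disappears from the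
  estimate.\<close>

lemma char_random_step_diff_le:
  assumes "real_distribution \<nu>" "real_distribution \<nu>'"
  shows "cmod (char (random_step \<Phi> N \<nu>) t - char (random_step \<Phi> N \<nu>') t) \<le>
    (\<integral>c. cmod (char \<nu> (t * P c) - char \<nu>' (t * P c)) \<partial>N)"
proof -
  interpret \<nu>: real_distribution \<nu> by fact
  interpret \<nu>': real_distribution \<nu>' by fact
  have int: "integrable N (\<lambda>c. iexp (t * Q c) * char \<nu> (t * P c))"
    "integrable N (\<lambda>c. iexp (t * Q c) * char \<nu>' (t * P c))"
    by (auto intro!: N.integrable_const_bound[where B = 1]
        simp: norm_mult \<nu>.cmod_char_le_1 \<nu>'.cmod_char_le_1)
  have "cmod (char (random_step \<Phi> N \<nu>) t - char (random_step \<Phi> N \<nu>') t) =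
      cmod (\<integral>c. iexp (t * Q c) * (char \<nu> (t * P c) - char \<nu>' (t * P c)) \<partial>N)"
    by (simp only: char_random_step assms right_diff_distrib Bochner_Integration.integral_diff [OF int])
  also have "\<dots> \<le> (\<integral>c. cmod (iexp (t * Q c) * (char \<nu> (t * P c) - char \<nu>' (t * P c))) \<partial>N)"
    by (rule integral_norm_bound)
  finally show ?thesis by (simp add: norm_mult)
qed

text \<open>The distance of the characteristic functions of two solutions, restricted to a compact
  interval, attains its maximum at a point \<open>t0\<close> of minimal absolute value; contracting \<open>t0\<close> by the
  random factor \<open>P\<close> would decrease it, unless \<open>t0 = 0\<close>.\<close>

lemma solves_random_eq_unique:
  assumes "solves_random_eq \<Phi> N \<nu>" "solves_random_eq \<Phi> N \<nu>'"
  shows "\<nu> = \<nu>'"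
proof -
  interpret \<nu>: real_distribution \<nu>
    using assms by (simp add: solves_random_eq_iff_fixpoint)
  interpret \<nu>': real_distribution \<nu>'
    using assms by (simp add: solves_random_eq_iff_fixpoint)
  define D where "D t = cmod (char \<nu> t - char \<nu>' t)" for t
  have cont: "continuous_on S D" for S
    unfolding D_def
    by (intro continuous_intros continuous_at_imp_continuous_on ballI \<nu>.isCont_char \<nu>'.isCont_char)
  have [measurable]: "D \<in> borel_measurable borel"
    unfolding D_def by measurable
  have D_le_2: "D t \<le> 2" for t
    unfolding D_def using norm_triangle_ineq4[of "char \<nu> t" "char \<nu>' t"]
      \<nu>.cmod_char_le_1[of t] \<nu>'.cmod_char_le_1[of t] by linarith
  have D_nonneg: "D t \<ge> 0" for t
    by (simp add: D_def)
  have int: "integrable N (\<lambda>c. D (t * P c))" for t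
    by (rule N.integrable_const_bound[where B = 2]) (auto simp: D_le_2 D_nonneg)
  have D_le: "D t \<le> (\<integral>c. D (t * P c) \<partial>N)" for t
    unfolding D_def using char_random_step_diff_le[OF \<nu>.real_distribution_axioms \<nu>'.real_distribution_axioms] assms
    by (simp add: solves_random_eq_iff_fixpoint)
  have "D T = 0" for T
  proof -
    obtain s where s: "s \<in> {-\<bar>T\<bar>..\<bar>T\<bar>}" "\<And>t. t \<in> {-\<bar>T\<bar>..\<bar>T\<bar>} \<Longrightarrow> D t \<le> D s"
      using continuous_attains_sup[of "{-\<bar>T\<bar>..\<bar>T\<bar>}" D] cont by auto
    let ?S = "{-\<bar>T\<bar>..\<bar>T\<bar>} \<inter> D -` {D s}"
    have "compact ?S"
      by (intro compact_Int_closed compact_Icc closed_vimage closed_singleton cont)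
    moreover have "?S \<noteq> {}"
      using s(1) by blast
    moreover have "continuous_on ?S abs"
      by (intro continuous_intros)
    ultimately obtain t0 where t0: "t0 \<in> ?S" "\<And>t. t \<in> ?S \<Longrightarrow> \<bar>t0\<bar> \<le> \<bar>t\<bar>"
      using continuous_attains_inf[of ?S abs] by blast
    have "t0 = 0"
    proof (rule ccontr)
      assume "t0 \<noteq> 0"
      have less: "AE c in N. D (t0 * P c) < D s"
        using AE_P
      proof eventually_elim
        case (elim c)
        then have lt: "\<bar>t0 * P c\<bar> < \<bar>t0\<bar>"
          using \<open>t0 \<noteq> 0\<close> by (simp add: abs_mult)
        then have mem: "t0 * P c \<in> {-\<bar>T\<bar>..\<bar>T\<bar>}"
          using t0(1) by auto
        then have "D (t0 * P c) \<noteq> D s"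
          using t0(2)[of "t0 * P c"] lt by auto
        then show ?case
          using s(2)[OF mem] by simp
      qed
      \<comment> \<open>On a probability space an almost sure strict inequality stays strict after
        integration; this contradicts \<open>D_le\<close> at \<open>t0\<close>, where
        \<open>D\<close> takes its maximal value.\<close>
      have "(\<integral>c. D (t0 * P c) \<partial>N) < (\<integral>c. D s \<partial>N)"
        using less by (intro N.integral_less_AE_space int) (simp_all add: N.emeasure_space_1)
      then show False
        using D_le[of t0] t0(1) N.prob_space by simp
    qed
    \<comment> \<open>Every characteristic function equals 1 at 0, so the maximum of
      \<open>D\<close> on the interval is 0.\<close>
    then have "D s = 0"
      using t0(1) by (simp add: D_def \<nu>.char_zero \<nu>'.char_zero)
    moreover have "T \<in> {-\<bar>T\<bar>..\<bar>T\<bar>}"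
      by auto
    ultimately show "D T = 0"
      using s(2)[of T] D_nonneg[of T] by linarith
  qed
  then have "char \<nu> = char \<nu>'"
    by (auto simp: D_def)
  then show ?thesis
    by (intro Levy_uniqueness \<nu>.real_distribution_axioms \<nu>'.real_distribution_axioms)
qed

text \<open>The mean of \<open>P\<close> is the contraction rate; it is strictly below 1 because
  \<open>P\<close> is so almost surely.\<close>

lemma expectation_P: "0 \<le> N.expectation P" "N.expectation P < 1" "integrable N P"
proof -
  show "integrable N P"
    using AE_P by (intro N.integrable_const_bound[where B = 1]) auto
  then have "N.expectation P < (\<integral>c. 1 \<partial>N)"
    using AE_P by (intro N.integral_less_AE_space) (auto simp: N.emeasure_space_1)
  then show "N.expectation P < 1"
    by (simp add: N.prob_space)
  show "0 \<le> N.expectation P"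
    using AE_P by (intro integral_nonneg_AE) auto
qed

lemma real_distribution_random_step_funpow:
  "real_distribution \<nu> \<Longrightarrow> real_distribution ((random_step \<Phi> N ^^ n) \<nu>)"
  by (induction n) (auto intro: real_distribution_random_step)

text \<open>The distance of the characteristic functions is at most \<open>K \<bar>t\<bar>\<close> initially, and every
  step multiplies this bound by the expectation of \<open>P\<close>.\<close>

lemma char_random_step_funpow_tendsto:
  assumes sol: "solves_random_eq \<Phi> N \<nu>0" and int: "integrable \<nu>0 (\<lambda>x. x)"
  shows "(\<lambda>n. char ((random_step \<Phi> N ^^ n) (return borel x)) t) \<longlonglongrightarrow> char \<nu>0 t"
proof -
  interpret \<nu>0: real_distribution \<nu>0
    using sol by (simp add: solves_random_eq_iff_fixpoint)
  have return: "real_distribution (return borel x)"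
    by (simp add: real_distribution_iff prob_space_return)
  define K where "K = (\<integral>z. \<bar>x - z\<bar> \<partial>\<nu>0)"
  define r where "r = N.expectation P"
  have int': "integrable \<nu>0 (\<lambda>z. \<bar>x - z\<bar>)"
    using int by simp
  have [simp]: "K \<ge> 0" "r \<ge> 0"
    using expectation_P by (auto simp: K_def r_def)
  \<comment> \<open>The induction covers all \<open>t\<close> at once, since the hypothesis is
    applied at \<open>t * P c\<close>.\<close>
  have bound: "cmod (char ((random_step \<Phi> N ^^ n) (return borel x)) t - char \<nu>0 t) \<le> K * \<bar>t\<bar> * r ^ n" for n t
  proof (induction n arbitrary: t)
    case 0
    have "char (return borel x) t - char \<nu>0 t = (\<integral>z. iexp (t * x) - iexp (t * z) \<partial>\<nu>0)"
      by (subst Bochner_Integration.integral_diff)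
         (simp_all add: char_def integral_return \<nu>0.integrable_iexp \<nu>0.prob_space del: \<nu>0.space_eq_univ)
    also have "cmod \<dots> \<le> (\<integral>z. cmod (iexp (t * x) - iexp (t * z)) \<partial>\<nu>0)"
      by (rule integral_norm_bound)
    also have "\<dots> \<le> (\<integral>z. \<bar>t\<bar> * \<bar>x - z\<bar> \<partial>\<nu>0)"
    proof (rule integral_mono')
      show "integrable \<nu>0 (\<lambda>z. \<bar>t\<bar> * \<bar>x - z\<bar>)"
        using int' by simp
      fix z
      have "iexp (t * x) - iexp (t * z) = iexp (t * z) * (iexp (t * (x - z)) - 1)"
        by (simp add: exp_add [symmetric] algebra_simps)
      then have "cmod (iexp (t * x) - iexp (t * z)) = cmod (iexp (t * (x - z)) - 1)"
        by (simp add: norm_mult)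
      also have "\<dots> \<le> \<bar>t * (x - z)\<bar>"
        using iexp_approx1[of "t * (x - z)" 0] by simp
      finally show "cmod (iexp (t * x) - iexp (t * z)) \<le> \<bar>t\<bar> * \<bar>x - z\<bar>"
        by (simp add: abs_mult)
    qed simp
    finally show ?case by (simp add: K_def mult.commute)
  next
    case (Suc n)
    have "cmod (char ((random_step \<Phi> N ^^ Suc n) (return borel x)) t - char \<nu>0 t) \<le>
      (\<integral>c. cmod (char ((random_step \<Phi> N ^^ n) (return borel x)) (t * P c) - char \<nu>0 (t * P c)) \<partial>N)"
      using char_random_step_diff_le[OF real_distribution_random_step_funpow[OF return] \<nu>0.real_distribution_axioms]
        sol by (simp add: solves_random_eq_iff_fixpoint)
    also have "\<dots> \<le> (\<integral>c. K * \<bar>t * P c\<bar> * r ^ n \<partial>N)"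
    proof (rule integral_mono')
      show "integrable N (\<lambda>c. K * \<bar>t * P c\<bar> * r ^ n)"
        using expectation_P(3) by (simp add: abs_mult)
    qed (use Suc in \<open>simp_all\<close>)
    also have "\<dots> = (\<integral>c. K * \<bar>t\<bar> * r ^ n * P c \<partial>N)"
    proof (rule integral_cong_AE)
      show "AE c in N. K * \<bar>t * P c\<bar> * r ^ n = K * \<bar>t\<bar> * r ^ n * P c"
        using AE_P by eventually_elim (simp add: abs_mult)
    qed simp_all
    also have "\<dots> = K * \<bar>t\<bar> * r ^ Suc n"
      by (simp add: r_def)
    finally show ?case .
  qed
  have "(\<lambda>n. K * \<bar>t\<bar> * r ^ n) \<longlonglongrightarrow> 0"
    using expectation_P by (intro tendsto_mult_right_zero LIMSEQ_realpow_zero) (auto simp: r_def)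
  then have "(\<lambda>n. char ((random_step \<Phi> N ^^ n) (return borel x)) t - char \<nu>0 t) \<longlonglongrightarrow> 0"
    by (rule Lim_null_comparison[OF always_eventually[OF allI[OF bound]]])
  then show ?thesis
    by (simp add: LIM_zero_iff)
qed

lemma weak_conv_random_step_funpow:
  assumes sol: "solves_random_eq \<Phi> N \<nu>0" and int: "integrable \<nu>0 (\<lambda>x. x)"
  shows "weak_conv_m (\<lambda>n. (random_step \<Phi> N ^^ n) (return borel x)) \<nu>0"
proof (rule levy_continuity)
  show "real_distribution ((random_step \<Phi> N ^^ n) (return borel x))" for n
    by (intro real_distribution_random_step_funpow) (simp add: real_distribution_iff prob_space_return)
  show "real_distribution \<nu>0"
    using sol by (simp add: solves_random_eq_iff_fixpoint)
qed (rule char_random_step_funpow_tendsto[OF assms])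

end

section \<open>Laws of forward and backward iterations\<close>

lemma forward_iter_cong:
  "(\<And>i. i \<in> {1..n} \<Longrightarrow> f i = g i) \<Longrightarrow> forward_iter f n = forward_iter g n"
  by (induction n) auto

lemma backward_iter_cong:
  "(\<And>i. i \<in> {1..n} \<Longrightarrow> f i = g i) \<Longrightarrow> backward_iter f n = backward_iter g n"
  by (induction n) auto

text \<open>Peels off the outermost map instead of the innermost one. This makes a backward
  iteration one random step applied to a shifted backward iteration.\<close>

lemma backward_iter_Suc_left:
  "backward_iter f (Suc n) = f 1 \<circ> backward_iter (\<lambda>i. f (Suc i)) n"
  by (induction n) (auto simp: fun_eq_iff)

text \<open>The library's \<open>indep_var\<close> relates variables with values in the same type only, so
  independence of \<open>X\<close> and \<open>Z j\<close> is expressed through their joint law.\<close>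

lemma (in prob_space) distr_step_indep_vars:
  fixes Z :: "'i \<Rightarrow> 'a \<Rightarrow> 'b::topological_space"
  assumes ind: "indep_vars (\<lambda>_. borel) Z I" and J: "insert j J \<subseteq> I" "j \<notin> J"
    and h: "h \<in> borel_measurable (PiM J (\<lambda>_. borel))"
    and X: "\<And>\<omega>. X \<omega> = h (restrict (\<lambda>i. Z i \<omega>) J)"
    and \<Phi>: "(\<lambda>(x, c). \<Phi> c x) \<in> borel_measurable (borel \<Otimes>\<^sub>M borel)"
  shows "distr M borel (\<lambda>\<omega>. \<Phi> (Z j \<omega>) (X \<omega>)) = random_step \<Phi> (distr M borel (Z j)) (distr M borel X)"
proof -
  let ?J = "PiM J (\<lambda>_. borel)" and ?j = "PiM {j} (\<lambda>_. borel)"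
  let ?R = "\<lambda>\<omega>. \<lambda>i\<in>J. Z i \<omega>" and ?r = "\<lambda>\<omega>. \<lambda>i\<in>{j}. Z i \<omega>"
  \<comment> \<open>Restrictions to disjoint index sets have a common type of functions, so
    \<open>indep_var\<close> applies to them; \<open>X\<close> and \<open>Z j\<close> are then
    images of the two blocks.\<close>
  have "indep_var ?J ?R ?j ?r"
    using J by (intro indep_var_restrict[OF ind]) auto
  then have R: "?R \<in> M \<rightarrow>\<^sub>M ?J" "?r \<in> M \<rightarrow>\<^sub>M ?j"
    and joint: "distr M ?J ?R \<Otimes>\<^sub>M distr M ?j ?r = distr M (?J \<Otimes>\<^sub>M ?j) (\<lambda>\<omega>. (?R \<omega>, ?r \<omega>))"
    by (simp_all add: indep_var_distribution_eq)
  have comp: "(\<lambda>z. z j) \<in> ?j \<rightarrow>\<^sub>M borel"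
    by (rule measurable_component_singleton) simp
  have X_fun: "X = h \<circ> ?R"
    by (auto simp: X)
  have X_eq: "distr M borel X = distr (distr M ?J ?R) borel h"
    by (subst distr_distr[OF h R(1)]) (simp add: X_fun)
  have Z_eq: "distr M borel (Z j) = distr (distr M ?j ?r) borel (\<lambda>z. z j)"
    by (subst distr_distr[OF comp R(2)]) (simp add: comp_def)
  have "random_variable borel (Z j)"
    using ind J by (auto simp: indep_vars_def)
  then interpret Zj: prob_space "distr M borel (Z j)"
    by (rule prob_space_distr)
  have pair: "(\<lambda>(x, y). (h x, y j)) \<in> ?J \<Otimes>\<^sub>M ?j \<rightarrow>\<^sub>M borel \<Otimes>\<^sub>M borel"
    using h comp by measurable
  have "distr M borel X \<Otimes>\<^sub>M distr M borel (Z j) =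
      distr (distr M ?J ?R \<Otimes>\<^sub>M distr M ?j ?r) (borel \<Otimes>\<^sub>M borel) (\<lambda>(x, y). (h x, y j))"
    unfolding X_eq Z_eq using h comp Zj.sigma_finite_measure_axioms
    by (intro pair_measure_distr) (simp_all add: Z_eq)
  also have "\<dots> = distr M (borel \<Otimes>\<^sub>M borel) (\<lambda>\<omega>. (X \<omega>, Z j \<omega>))"
    unfolding joint by (subst distr_distr[OF pair measurable_Pair[OF R]]) (simp add: comp_def X)
  finally have joint_eq: "distr M borel X \<Otimes>\<^sub>M distr M borel (Z j) =
      distr M (borel \<Otimes>\<^sub>M borel) (\<lambda>\<omega>. (X \<omega>, Z j \<omega>))" .
  have "random_variable borel X"
    using measurable_comp[OF R(1) h] by (simp add: X_fun)
  then have "random_variable (borel \<Otimes>\<^sub>M borel) (\<lambda>\<omega>. (X \<omega>, Z j \<omega>))"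
    using \<open>random_variable borel (Z j)\<close> by (rule measurable_Pair)
  from distr_distr[OF \<Phi> this] show ?thesis
    by (simp add: random_step_def joint_eq comp_def)
qed

lemma measurable_forward_iter:
  assumes \<Phi>: "(\<lambda>(x, c). \<Phi> c x) \<in> borel_measurable (borel \<Otimes>\<^sub>M borel)" and "{1..n} \<subseteq> J"
  shows "(\<lambda>z. forward_iter (\<lambda>i. \<Phi> (z i)) n x) \<in> borel_measurable (PiM J (\<lambda>_. borel))"
  using assms(2)
proof (induction n)
  case (Suc n)
  then have "(\<lambda>z. forward_iter (\<lambda>i. \<Phi> (z i)) n x) \<in> borel_measurable (PiM J (\<lambda>_. borel))"
    by (intro Suc.IH) auto
  moreover have "Suc n \<in> J"
    using Suc.prems by auto
  ultimately have "(\<lambda>z. (forward_iter (\<lambda>i. \<Phi> (z i)) n x, z (Suc n))) \<in>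
      PiM J (\<lambda>_. borel) \<rightarrow>\<^sub>M borel \<Otimes>\<^sub>M borel"
    by (intro measurable_Pair measurable_component_singleton)
  from measurable_compose[OF this \<Phi>] show ?case by simp
qed simp

text \<open>The shift \<open>k\<close> is carried along because peeling off the outermost map moves
  all remaining indices by one.\<close>

lemma measurable_backward_iter:
  assumes \<Phi>: "(\<lambda>(x, c). \<Phi> c x) \<in> borel_measurable (borel \<Otimes>\<^sub>M borel)" and "{k + 1..k + n} \<subseteq> J"
  shows "(\<lambda>z. backward_iter (\<lambda>i. \<Phi> (z (i + k))) n x) \<in> borel_measurable (PiM J (\<lambda>_. borel))"
  using assms(2)
proof (induction n arbitrary: k)
  case (Suc n)
  have "(\<lambda>z. backward_iter (\<lambda>i. \<Phi> (z (i + Suc k))) n x) \<in> borel_measurable (PiM J (\<lambda>_. borel))"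
    by (rule Suc.IH) (use Suc.prems in auto)
  moreover have "k + 1 \<in> J"
    using Suc.prems by auto
  ultimately have "(\<lambda>z. (backward_iter (\<lambda>i. \<Phi> (z (i + Suc k))) n x, z (k + 1))) \<in>
      PiM J (\<lambda>_. borel) \<rightarrow>\<^sub>M borel \<Otimes>\<^sub>M borel"
    by (intro measurable_Pair measurable_component_singleton)
  from measurable_compose[OF this \<Phi>] show ?case
    by (simp add: backward_iter_Suc_left del: backward_iter.simps)
qed simp

context
  fixes M :: "'a measure" and Z :: "nat \<Rightarrow> 'a \<Rightarrow> 'b::topological_space"
    and \<Phi> :: "'b \<Rightarrow> real \<Rightarrow> real" and N :: "'b measure"
  assumes iid: "iid_with_law M Z {1..} N"
    and \<Phi>: "(\<lambda>(x, c). \<Phi> c x) \<in> borel_measurable (borel \<Otimes>\<^sub>M borel)"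
begin

interpretation prob_space M
  using iid by (simp add: iid_with_law_def)

lemma iid_indep_vars: "indep_vars (\<lambda>_. borel) Z {1..}"
  and iid_distr: "i \<ge> 1 \<Longrightarrow> distr M borel (Z i) = N"
  using iid by (simp_all add: iid_with_law_def)

lemma distr_forward_iter:
  "distr M borel (\<lambda>\<omega>. forward_iter (\<lambda>i. \<Phi> (Z i \<omega>)) n x) = (random_step \<Phi> N ^^ n) (return borel x)"
proof (induction n)
  case 0
  then show ?case by (simp add: distr_const)
next
  case (Suc n)
  have "distr M borel (\<lambda>\<omega>. \<Phi> (Z (Suc n) \<omega>) (forward_iter (\<lambda>i. \<Phi> (Z i \<omega>)) n x)) =
    random_step \<Phi> (distr M borel (Z (Suc n))) (distr M borel (\<lambda>\<omega>. forward_iter (\<lambda>i. \<Phi> (Z i \<omega>)) n x))"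
  proof (rule distr_step_indep_vars[OF iid_indep_vars _ _ measurable_forward_iter[OF \<Phi> order_refl] _ \<Phi>])
    show "forward_iter (\<lambda>i. \<Phi> (Z i \<omega>)) n x =
        forward_iter (\<lambda>i. \<Phi> ((\<lambda>i\<in>{1..n}. Z i \<omega>) i)) n x" for \<omega>
      by (rule fun_cong[OF forward_iter_cong]) simp
  qed auto
  with Suc show ?case by (simp add: iid_distr)
qed

text \<open>The outermost map uses index \<open>k + 1\<close> and the inner ones only later indices,
  so they are independent. The law agrees with that in \<open>distr_forward_iter\<close>: forward
  and backward iterations have the same law for each fixed \<open>n\<close>.\<close>

lemma distr_backward_iter:
  "distr M borel (\<lambda>\<omega>. backward_iter (\<lambda>i. \<Phi> (Z (i + k) \<omega>)) n x) = (random_step \<Phi> N ^^ n) (return borel x)"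
proof (induction n arbitrary: k)
  case 0
  then show ?case by (simp add: distr_const)
next
  case (Suc n)
  have "distr M borel (\<lambda>\<omega>. \<Phi> (Z (k + 1) \<omega>) (backward_iter (\<lambda>i. \<Phi> (Z (i + Suc k) \<omega>)) n x)) =
    random_step \<Phi> (distr M borel (Z (k + 1))) (distr M borel (\<lambda>\<omega>. backward_iter (\<lambda>i. \<Phi> (Z (i + Suc k) \<omega>)) n x))"
  proof (rule distr_step_indep_vars[OF iid_indep_vars _ _ measurable_backward_iter[OF \<Phi> order_refl] _ \<Phi>])
    show "backward_iter (\<lambda>i. \<Phi> (Z (i + Suc k) \<omega>)) n x =
        backward_iter (\<lambda>i. \<Phi> ((\<lambda>i\<in>{Suc k + 1..Suc k + n}. Z i \<omega>) (i + Suc k))) n x" for \<omega>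
      by (rule fun_cong[OF backward_iter_cong]) simp
  qed auto
  with Suc[of "Suc k"] show ?case
    by (simp add: iid_distr backward_iter_Suc_left del: backward_iter.simps)
qed

lemma borel_measurable_backward_iter:
  "(\<lambda>\<omega>. backward_iter (\<lambda>i. \<Phi> (Z i \<omega>)) n x) \<in> borel_measurable M"
proof -
  have "(\<lambda>\<omega>. \<lambda>i\<in>{1..n}. Z i \<omega>) \<in> M \<rightarrow>\<^sub>M PiM {1..n} (\<lambda>_. borel)"
    using iid_indep_vars by (intro measurable_restrict) (auto simp: indep_vars_def)
  from measurable_compose[OF this measurable_backward_iter[of \<Phi> 0 n, OF \<Phi>]]
  have "(\<lambda>\<omega>. backward_iter (\<lambda>i. \<Phi> ((\<lambda>i\<in>{1..n}. Z i \<omega>) i)) n x) \<in> borel_measurable M"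
    by simp
  also have "(\<lambda>\<omega>. backward_iter (\<lambda>i. \<Phi> ((\<lambda>i\<in>{1..n}. Z i \<omega>) i)) n x) =
      (\<lambda>\<omega>. backward_iter (\<lambda>i. \<Phi> (Z i \<omega>)) n x)"
    by (intro ext fun_cong[OF backward_iter_cong]) simp
  finally show ?thesis .
qed

end

lemma iid_with_law_compose:
  assumes iid: "iid_with_law M Z I N" and g: "g \<in> borel \<rightarrow>\<^sub>M borel"
  shows "iid_with_law M (\<lambda>i \<omega>. g (Z i \<omega>)) I (distr N borel g)"
proof -
  interpret prob_space M using iid by (simp add: iid_with_law_def)
  have Z: "indep_vars (\<lambda>_. borel) Z I" "\<And>i. i \<in> I \<Longrightarrow> distr M borel (Z i) = N"
    using iid by (auto simp: iid_with_law_def)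
  have "distr M borel (\<lambda>\<omega>. g (Z i \<omega>)) = distr N borel g" if "i \<in> I" for i
  proof -
    have "random_variable borel (Z i)"
      using Z(1) that by (auto simp: indep_vars_def)
    from distr_distr[OF g this] show ?thesis
      using Z(2)[OF that] by (simp add: comp_def)
  qed
  then show ?thesis
    using indep_vars_compose2[OF Z(1) g] prob_space_axioms by (simp add: iid_with_law_def)
qed

section \<open>Almost sure convergence of the backward iteration\<close>

text \<open>The images of \<open>[0, 1]\<close> form a decreasing sequence of intervals
  \<open>[b n, b n + c n]\<close> whose length is the product of the slopes.\<close>

lemma uniform_limit_backward_iter_affine:
  fixes p q :: "nat \<Rightarrow> real"
  assumes pq: "\<And>i. i \<ge> 1 \<Longrightarrow> 0 \<le> p i \<and> 0 \<le> q i \<and> p i + q i \<le> 1"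
    and lim: "(\<lambda>n. \<Prod>i=1..n. p i) \<longlonglongrightarrow> 0"
    and f: "\<And>i x. f i x = p i * x + q i"
  shows "uniform_limit {0..1} (backward_iter f) (\<lambda>_. lim (\<lambda>n. backward_iter f n 0)) sequentially"
proof -
  define c where "c n = (\<Prod>i=1..n. p i)" for n
  define b where "b n = backward_iter f n 0" for n
  have affine: "backward_iter f n x = c n * x + b n" for n x
  proof (induction n arbitrary: x)
    case (Suc n)
    \<comment> \<open>Taking the difference of the hypothesis at \<open>f (Suc n) x\<close> and at
      \<open>f (Suc n) 0\<close> eliminates \<open>b n\<close>.\<close>
    have "backward_iter f (Suc n) x = c n * (f (Suc n) x - f (Suc n) 0) + backward_iter f (Suc n) 0"
      using Suc[of "f (Suc n) x"] Suc[of "f (Suc n) 0"] by (simp add: algebra_simps)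
    also have "f (Suc n) x - f (Suc n) 0 = p (Suc n) * x"
      by (simp add: f)
    finally show ?case
      by (simp add: b_def c_def mult.assoc)
  qed (simp add: b_def c_def)
  have c_Suc: "c (Suc n) = c n * p (Suc n)" for n
    by (simp add: c_def)
  have b_Suc: "b (Suc n) = c n * q (Suc n) + b n" for n
    using affine[of n "f (Suc n) 0"] by (simp add: f b_def)
  have c_nonneg: "0 \<le> c n" for n
    unfolding c_def using pq by (intro prod_nonneg) auto
  have inc: "incseq b"
    using pq c_nonneg by (intro incseq_SucI) (simp add: b_Suc)
  \<comment> \<open>This is the image of 1, the right end of the interval; it decreases because
    \<open>p i + q i\<close> is at most 1.\<close>
  have dec: "decseq (\<lambda>n. b n + c n)"
  proof (rule decseq_SucI)
    fix n
    have "c n * (p (Suc n) + q (Suc n)) \<le> c n * 1"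
      using pq[of "Suc n"] c_nonneg by (intro mult_left_mono) auto
    then show "b (Suc n) + c (Suc n) \<le> b n + c n"
      by (simp add: b_Suc c_Suc algebra_simps)
  qed
  have "b n \<le> 1" for n
    using decseqD[OF dec, of 0 n] c_nonneg[of n] by (simp add: b_def c_def)
  then obtain L where L: "b \<longlonglongrightarrow> L"
    using incseq_convergent[OF inc, of 1] by blast
  have "(\<lambda>n. b n + c n) \<longlonglongrightarrow> L + 0"
    using lim by (intro tendsto_add L) (simp add: c_def)
  then have bounds: "b n \<le> L" "L \<le> b n + c n" for n
    using incseq_le[OF inc L] decseq_ge[OF dec, of L n] by auto
  have "lim b = L"
    by (rule limI[OF L])
  then have lim_eq: "lim (\<lambda>n. backward_iter f n 0) = L"
    by (simp add: b_def [abs_def])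
  show ?thesis
    unfolding lim_eq
  proof (rule uniform_limitI)
    fix e :: real assume "e > 0"
    have "c \<longlonglongrightarrow> 0"
      using lim by (simp add: c_def [abs_def])
    from order_tendstoD(2)[OF this \<open>e > 0\<close>]
    show "\<forall>\<^sub>F n in sequentially. \<forall>x\<in>{0..1}. dist (backward_iter f n x) L < e"
    proof eventually_elim
      case (elim n)
      show ?case
      proof
        fix x :: real assume "x \<in> {0..1}"
        then have "0 \<le> c n * x" "c n * x \<le> c n"
          using c_nonneg[of n] by (auto intro: mult_left_le)
        then show "dist (backward_iter f n x) L < e"
          unfolding affine dist_real_def using bounds[of n] elim by (auto simp: abs_if)
      qed
    qed
  qed
qed

text \<open>The expectations \<open>r ^ n\<close> are summable, hence so are almost surely the products themselves.\<close>

lemma (in prob_space) AE_prod_tendsto_0: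
  fixes p :: "nat \<Rightarrow> 'a \<Rightarrow> real"
  assumes ind: "indep_vars (\<lambda>_. borel) p {1..}"
    and AE_p: "\<And>i. i \<ge> 1 \<Longrightarrow> AE \<omega> in M. 0 \<le> p i \<omega> \<and> p i \<omega> \<le> 1"
    and exp_p: "\<And>i. i \<ge> 1 \<Longrightarrow> expectation (p i) = r" and "r < 1"
  shows "AE \<omega> in M. (\<lambda>n. \<Prod>i=1..n. p i \<omega>) \<longlonglongrightarrow> 0"
proof -
  have [measurable]: "p i \<in> borel_measurable M" if "i \<ge> 1" for i
    using ind that by (auto simp: indep_vars_def)
  have [measurable]: "(\<lambda>\<omega>. \<Prod>i=1..n. p i \<omega>) \<in> borel_measurable M" for n
    by (rule borel_measurable_prod) auto
  have int: "integrable M (p i)" if "i \<ge> 1" for i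
    using AE_p[OF that] that by (intro integrable_const_bound[where B = 1]) auto
  have "r = expectation (p 1)"
    by (simp add: exp_p)
  also have "\<dots> \<ge> 0"
    using AE_p[of 1] by (intro integral_nonneg_AE) auto
  finally have "r \<ge> 0" .
  have AE_all: "AE \<omega> in M. \<forall>i\<in>{1..}. 0 \<le> p i \<omega> \<and> p i \<omega> \<le> 1"
    using AE_p by (subst AE_ball_countable) auto
  have ind_n: "indep_vars (\<lambda>_. borel) p {1..n}" for n
    by (rule indep_vars_subset[OF ind]) auto
  have nn: "(\<integral>\<^sup>+\<omega>. ennreal (\<Prod>i=1..n. p i \<omega>) \<partial>M) = ennreal (r ^ n)" for n
  proof -
    have "(\<integral>\<^sup>+\<omega>. ennreal (\<Prod>i=1..n. p i \<omega>) \<partial>M) = ennreal (expectation (\<lambda>\<omega>. \<Prod>i=1..n. p i \<omega>))"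
    proof (rule nn_integral_eq_integral)
      show "integrable M (\<lambda>\<omega>. \<Prod>i=1..n. p i \<omega>)"
        by (rule indep_vars_integrable[OF _ ind_n]) (auto intro: int)
      show "AE \<omega> in M. 0 \<le> (\<Prod>i=1..n. p i \<omega>)"
        using AE_all by eventually_elim (auto intro: prod_nonneg)
    qed
    also have "expectation (\<lambda>\<omega>. \<Prod>i=1..n. p i \<omega>) = (\<Prod>i=1..n. expectation (p i))"
      by (rule indep_vars_lebesgue_integral[OF _ ind_n]) (auto intro: int)
    also have "\<dots> = r ^ n"
      by (simp add: exp_p)
    finally show ?thesis .
  qed
  have "(\<integral>\<^sup>+\<omega>. (\<Sum>n. ennreal (\<Prod>i=1..n. p i \<omega>)) \<partial>M) = (\<Sum>n. ennreal (r ^ n))"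
    by (subst nn_integral_suminf) (simp_all only: nn, measurable)
  also have "\<dots> \<noteq> \<infinity>"
    using \<open>r \<ge> 0\<close> \<open>r < 1\<close> by (subst suminf_ennreal2) auto
  finally have "AE \<omega> in M. (\<Sum>n. ennreal (\<Prod>i=1..n. p i \<omega>)) \<noteq> \<infinity>"
    by (intro nn_integral_PInf_AE) auto
  with AE_all show ?thesis
  proof eventually_elim
    case (elim \<omega>)
    then have "summable (\<lambda>n. \<Prod>i=1..n. p i \<omega>)"
      by (intro summable_suminf_not_top) (auto intro: prod_nonneg)
    then show ?case
      by (rule summable_LIMSEQ_zero)
  qed
qed

section \<open>The beta and gamma recursions\<close>

lemma integrable_beta_law:
  assumes "a > 0" "b > 0"
  shows "integrable (beta_law a b) (\<lambda>x. x)"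
proof -
  interpret prob_space "beta_law a b"
    using assms by (rule prob_space_beta_law)
  show ?thesis
    using AE_beta_law[of a b] by (intro integrable_const_bound[where B = 1]) auto
qed

text \<open>Multiplying the gamma density of shape \<open>a\<close> by \<open>x\<close> gives a
  multiple of the density of shape \<open>a + 1\<close>; the factor \<open>k\<close> is the
  mean.\<close>

lemma integrable_gamma_law:
  assumes "a > 0"
  shows "integrable (gamma_law a) (\<lambda>x. x)"
proof (rule integrableI_bounded)
  define k where "k = Gamma (a + 1) / Gamma a"
  have pos: "Gamma (a + 1) > 0" "Gamma a > 0"
    using assms by (auto intro!: Gamma_real_pos)
  have eq: "gamma_density a x * \<bar>x\<bar> = k * gamma_density (a + 1) x" for x
  proof -
    have "x powr (a - 1) * x = x powr a" if "x > 0"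
      using that powr_mult_base[of x "a - 1"] by (simp add: mult.commute)
    then show ?thesis
      using pos by (auto simp: gamma_density_def k_def field_simps)
  qed
  have "(\<integral>\<^sup>+x. ennreal (norm x) \<partial>gamma_law a) = (\<integral>\<^sup>+x. ennreal k * ennreal (gamma_density (a + 1) x) \<partial>lborel)"
    using assms pos by (simp add: gamma_law_eq_density nn_integral_density ennreal_mult' [symmetric]
      gamma_density_nonneg eq k_def)
  also have "\<dots> = ennreal k * emeasure (gamma_law (a + 1)) UNIV"
    by (simp add: nn_integral_cmult gamma_law_eq_density emeasure_density)
  also have "\<dots> < \<infinity>"
    using prob_space.emeasure_space_1[OF prob_space_gamma_law[of "a + 1"]] assms by simp
  finally show "(\<integral>\<^sup>+x. ennreal (norm x) \<partial>gamma_law a) < \<infinity>" .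
qed simp

text \<open>The second coordinate is the first times a factor in the open unit interval. These
  bounds place both slopes, \<open>A\<close> and \<open>A - B\<close>, strictly between 0 and
  1.\<close>

lemma AE_AB_law:
  assumes "w > 0" "y > 0"
  shows "AE c in AB_law w y. 0 < snd c \<and> snd c < fst c \<and> fst c < 1"
proof -
  interpret pair_sigma_finite "beta_law (w + y) y" "beta_law y w" ..
  have "AE z in beta_law (w + y) y \<Otimes>\<^sub>M beta_law y w. (0 < fst z \<and> fst z < 1) \<and> (0 < snd z \<and> snd z < 1)"
  proof (rule AE_pair_measure)
    show "AE a in beta_law (w + y) y. AE b in beta_law y w.
        (0 < fst (a, b) \<and> fst (a, b) < 1) \<and> (0 < snd (a, b) \<and> snd (a, b) < 1)"
      using AE_beta_law[of "w + y" y]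
    proof eventually_elim
      case (elim a)
      show ?case
        using AE_beta_law[of y w] by eventually_elim (simp add: elim)
    qed
  qed measurable
  then show ?thesis
    unfolding AB_law_def borel_prod [symmetric]
    by (subst AE_distr_iff) (auto simp: case_prod_beta)
qed

text \<open>Dominated convergence, the integrands having modulus 1.\<close>

lemma (in prob_space) char_distr_tendsto_AE:
  assumes [measurable]: "\<And>n. X n \<in> borel_measurable M" "Y \<in> borel_measurable M"
    and AE: "AE \<omega> in M. (\<lambda>n. X n \<omega>) \<longlonglongrightarrow> Y \<omega>"
  shows "(\<lambda>n. char (distr M borel (X n)) t) \<longlonglongrightarrow> char (distr M borel Y) t"
proof -
  have "(\<lambda>n. \<integral>\<omega>. iexp (t * X n \<omega>) \<partial>M) \<longlonglongrightarrow> (\<integral>\<omega>. iexp (t * Y \<omega>) \<partial>M)"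
  proof (rule integral_dominated_convergence[where w = "\<lambda>_. 1"])
    show "AE \<omega> in M. (\<lambda>n. iexp (t * X n \<omega>)) \<longlonglongrightarrow> iexp (t * Y \<omega>)"
      using AE by eventually_elim (intro tendsto_intros)
  qed auto
  then show ?thesis
    by (simp add: char_def integral_distr)
qed

lemma affine_recursion_gamma:
  assumes "w > 0" "y > 0"
  shows "affine_recursion (gamma_law (w + y) \<Otimes>\<^sub>M AB_law w y) (\<lambda>c. fst (snd c)) (\<lambda>c. snd (snd c) * fst c)
    (\<lambda>(v2, (\<alpha>, \<beta>)) v1. \<alpha> * v1 + \<beta> * v2)"
proof -
  interpret g: prob_space "gamma_law (w + y)" using assms by (intro prob_space_gamma_law) simp
  interpret AB: prob_space "AB_law w y" using assms by (rule prob_space_AB_law)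
  interpret pair_prob_space "gamma_law (w + y)" "AB_law w y" ..
  have AE_A: "AE c in AB_law w y. 0 < fst c \<and> fst c < 1"
    using AE_AB_law[OF assms] by eventually_elim auto
  show ?thesis
  proof
    show "AE c in gamma_law (w + y) \<Otimes>\<^sub>M AB_law w y. 0 < fst (snd c) \<and> fst (snd c) < 1"
    proof (rule AE_pair_measure)
      show "AE v in gamma_law (w + y). AE c in AB_law w y. 0 < fst (snd (v, c)) \<and> fst (snd (v, c)) < 1"
        using AE_A by simp
    qed measurable
  qed (auto simp: case_prod_beta)
qed

lemma affine_recursion_beta:
  assumes "w > 0" "y > 0"
  shows "affine_recursion (AB_law w y) (\<lambda>c. fst c - snd c) snd (\<lambda>(\<alpha>, \<beta>) x. \<alpha> * x + \<beta> * (1 - x))"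
proof -
  interpret AB: prob_space "AB_law w y" using assms by (rule prob_space_AB_law)
  show ?thesis
  proof
    show "AE c in AB_law w y. 0 < fst c - snd c \<and> fst c - snd c < 1"
      using AE_AB_law[OF assms] by eventually_elim auto
  qed (auto simp: case_prod_beta algebra_simps)
qed

lemma distr_AB_gamma_fst:
  assumes "prob_space (gamma_law b)"
  shows "distr (AB_law w y \<Otimes>\<^sub>M gamma_law b) borel fst = AB_law w y"
proof -
  have "distr (AB_law w y \<Otimes>\<^sub>M gamma_law b) borel fst = distr (AB_law w y \<Otimes>\<^sub>M gamma_law b) (AB_law w y) fst"
    by (rule distr_cong) (simp_all add: borel_prod [symmetric])
  then show ?thesis
    using prob_space.distr_pair_fst[OF assms] by simp
qed

text \<open>The i.i.d. sequence lists the pair before the gamma variable, the random equation the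
  other way round.\<close>

lemma distr_AB_gamma_swap:
  assumes "w > 0" "y > 0"
  shows "distr (AB_law w y \<Otimes>\<^sub>M gamma_law b) borel (\<lambda>(c, v). (v, c)) = gamma_law b \<Otimes>\<^sub>M AB_law w y"
proof -
  interpret AB: prob_space "AB_law w y" using assms by (rule prob_space_AB_law)
  interpret pair_sigma_finite "gamma_law b" "AB_law w y" ..
  have "sets (gamma_law b \<Otimes>\<^sub>M AB_law w y) = sets (borel \<Otimes>\<^sub>M (borel \<Otimes>\<^sub>M borel))"
    by (rule sets_pair_measure_cong) simp_all
  then show ?thesis
    by (subst distr_pair_swap, intro distr_cong) (simp_all add: borel_prod [symmetric])
qed

text \<open>Convergence is a pathwise fact once the product of the slopes tends to 0. The law of the
  limit is found by computing the limit of the characteristic functions of the iterates from 0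
  twice: almost sure convergence gives that of \<open>Y\<close>, contraction gives that of the beta
  law.\<close>

lemma backward_iter_beta:
  fixes A B :: "nat \<Rightarrow> 'a \<Rightarrow> real"
  assumes pos: "w > 0" "y > 0"
    and iid: "iid_with_law M (\<lambda>n \<omega>. (A n \<omega>, B n \<omega>)) {1..} (AB_law w y)"
  defines "F \<equiv> \<lambda>\<omega> n x. A n \<omega> * x + B n \<omega> * (1 - x)"
  shows "\<exists>Y \<in> borel_measurable M. distr M borel Y = beta_law (w + y) (w + y) \<and>
    (AE \<omega> in M. uniform_limit {0..1} (\<lambda>n. backward_iter (F \<omega>) n) (\<lambda>x. Y \<omega>) sequentially)"
proof -
  let ?\<Phi> = "\<lambda>(\<alpha>, \<beta>) x. \<alpha> * x + \<beta> * (1 - x) :: real" and ?N = "AB_law w y"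
  let ?\<nu> = "beta_law (w + y) (w + y)"
  interpret prob_space M using iid by (simp add: iid_with_law_def)
  interpret rec: affine_recursion ?N "\<lambda>c. fst c - snd c" snd ?\<Phi>
    using pos by (rule affine_recursion_beta)
  have \<Phi>: "(\<lambda>(x, c). ?\<Phi> c x) \<in> borel_measurable (borel \<Otimes>\<^sub>M borel)"
    by (simp add: borel_prod [symmetric] case_prod_beta)
  have F: "F \<omega> = (\<lambda>i. ?\<Phi> (A i \<omega>, B i \<omega>))" for \<omega>
    by (simp add: F_def)
  have ind: "indep_vars (\<lambda>_. borel) (\<lambda>n \<omega>. (A n \<omega>, B n \<omega>)) {1..}"
    and law: "\<And>n. n \<ge> 1 \<Longrightarrow> distr M borel (\<lambda>\<omega>. (A n \<omega>, B n \<omega>)) = ?N"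
    using iid by (simp_all add: iid_with_law_def)
  have rv: "random_variable borel (\<lambda>\<omega>. (A n \<omega>, B n \<omega>))" if "n \<ge> 1" for n
    using ind that by (auto simp: indep_vars_def)
  have AE_AB: "AE \<omega> in M. 0 < B n \<omega> \<and> B n \<omega> < A n \<omega> \<and> A n \<omega> < 1" if "n \<ge> 1" for n
  proof -
    have "AE c in distr M borel (\<lambda>\<omega>. (A n \<omega>, B n \<omega>)). 0 < snd c \<and> snd c < fst c \<and> fst c < 1"
      unfolding law[OF that] by (rule AE_AB_law[OF pos])
    from AE_distrD[OF rv[OF that] this] show ?thesis
      by (simp only: fst_conv snd_conv)
  qed
  \<comment> \<open>Defined as a \<open>lim\<close> at every sample point, \<open>Y\<close> is
    measurable; its values where the limit fails to exist lie in a null set.\<close>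
  define Y where "Y \<omega> = lim (\<lambda>n. backward_iter (F \<omega>) n 0)" for \<omega>
  have meas: "(\<lambda>\<omega>. backward_iter (F \<omega>) n 0) \<in> borel_measurable M" for n
    unfolding F by (rule borel_measurable_backward_iter[OF iid \<Phi>])
  then have Y: "Y \<in> borel_measurable M"
    unfolding Y_def by (rule borel_measurable_lim_metric)
  have diff: "(\<lambda>c. fst c - snd c) \<in> borel_measurable (borel :: (real \<times> real) measure)"
    by (simp add: borel_prod [symmetric])
  have "AE \<omega> in M. (\<lambda>n. \<Prod>i=1..n. A i \<omega> - B i \<omega>) \<longlonglongrightarrow> 0"
  proof (rule AE_prod_tendsto_0)
    show "indep_vars (\<lambda>_. borel) (\<lambda>n \<omega>. A n \<omega> - B n \<omega>) {1..}"
      using indep_vars_compose2[OF ind diff] by simp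
    show "AE \<omega> in M. 0 \<le> A n \<omega> - B n \<omega> \<and> A n \<omega> - B n \<omega> \<le> 1" if "n \<ge> 1" for n
      using AE_AB[OF that] by eventually_elim auto
    show "expectation (\<lambda>\<omega>. A n \<omega> - B n \<omega>) = rec.N.expectation (\<lambda>c. fst c - snd c)" if "n \<ge> 1" for n
      using integral_distr[OF rv[OF that] diff] law[OF that] by simp
  qed (rule rec.expectation_P)
  moreover have "AE \<omega> in M. \<forall>n\<in>{1..}. 0 < B n \<omega> \<and> B n \<omega> < A n \<omega> \<and> A n \<omega> < 1"
    using AE_AB by (subst AE_ball_countable) auto
  ultimately have unif: "AE \<omega> in M. uniform_limit {0..1} (\<lambda>n. backward_iter (F \<omega>) n) (\<lambda>x. Y \<omega>) sequentially"
  proof eventually_elim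
    case (elim \<omega>)
    show ?case
      unfolding Y_def
    proof (rule uniform_limit_backward_iter_affine)
      show "0 \<le> A i \<omega> - B i \<omega> \<and> 0 \<le> B i \<omega> \<and> A i \<omega> - B i \<omega> + B i \<omega> \<le> 1" if "i \<ge> 1" for i
        using elim(2)[rule_format, of i] that by auto
      show "F \<omega> i x = (A i \<omega> - B i \<omega>) * x + B i \<omega>" for i x
        by (simp add: F_def algebra_simps)
    qed (rule elim)
  qed
  then have "AE \<omega> in M. (\<lambda>n. backward_iter (F \<omega>) n 0) \<longlonglongrightarrow> Y \<omega>"
    by eventually_elim (erule tendsto_uniform_limitI, simp)
  then have lim_Y: "(\<lambda>n. char (distr M borel (\<lambda>\<omega>. backward_iter (F \<omega>) n 0)) t) \<longlonglongrightarrow> char (distr M borel Y) t" for t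
    by (rule char_distr_tendsto_AE[OF meas Y])
  have law_n: "distr M borel (\<lambda>\<omega>. backward_iter (F \<omega>) n 0) = (random_step ?\<Phi> ?N ^^ n) (return borel 0)" for n
    using distr_backward_iter[OF iid \<Phi>, of 0 n 0] by (simp add: F)
  have lim_\<nu>: "(\<lambda>n. char ((random_step ?\<Phi> ?N ^^ n) (return borel 0)) t) \<longlonglongrightarrow> char ?\<nu> t" for t
    using pos by (intro rec.char_random_step_funpow_tendsto solves_random_eq_beta integrable_beta_law) simp_all
  have "char (distr M borel Y) t = char ?\<nu> t" for t
    by (rule LIMSEQ_unique[OF lim_Y[unfolded law_n] lim_\<nu>])
  then have "char (distr M borel Y) = char ?\<nu>"
    by (rule ext)
  moreover have "real_distribution ?\<nu>"
    using pos by (simp add: real_distribution_iff prob_space_beta_law)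
  ultimately have "distr M borel Y = ?\<nu>"
    using Y by (intro Levy_uniqueness real_distribution_distr)
  with Y unif show ?thesis
    by blast
qed

theorem theorem8:
  fixes w y a b :: real
    and M :: "'a measure" and A B V :: "nat \<Rightarrow> 'a \<Rightarrow> real"
  defines "F \<equiv> \<lambda>\<omega> n x. A n \<omega> * x + B n \<omega> * (1 - x)"
    and "G \<equiv> \<lambda>\<omega> n x. A n \<omega> * x + B n \<omega> * V n \<omega>"
  assumes "w > 0" and "y > 0" and "a = w + y" and "b = w + y"
  shows
    "unique_solution (\<lambda>(v2, (\<alpha>, \<beta>)) v1. \<alpha> * v1 + \<beta> * v2) (gamma_law b \<Otimes>\<^sub>M AB_law w y) (gamma_law a) \<and>
     unique_solution (\<lambda>(\<alpha>, \<beta>) x. \<alpha> * x + \<beta> * (1 - x)) (AB_law w y) (beta_law a b) \<and>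
     (iid_with_law M (\<lambda>n \<omega>. ((A n \<omega>, B n \<omega>), V n \<omega>)) {1..} (AB_law w y \<Otimes>\<^sub>M gamma_law b) \<longrightarrow>
       (\<exists>Y \<in> borel_measurable M. distr M borel Y = beta_law a b \<and>
          (AE \<omega> in M. uniform_limit {0..1} (\<lambda>n. backward_iter (F \<omega>) n) (\<lambda>x. Y \<omega>) sequentially)) \<and>
       (\<forall>x \<in> {0..1}. weak_conv_m (\<lambda>n. distr M borel (\<lambda>\<omega>. forward_iter (F \<omega>) n x)) (beta_law a b)) \<and>
       (\<forall>x' \<in> {0<..}. weak_conv_m (\<lambda>n. distr M borel (\<lambda>\<omega>. forward_iter (G \<omega>) n x')) (gamma_law a)))"
proof -
  let ?\<Phi> = "\<lambda>(\<alpha>, \<beta>) x. \<alpha> * x + \<beta> * (1 - x) :: real"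
  let ?\<Psi> = "\<lambda>(v2, (\<alpha>, \<beta>)) v1. \<alpha> * v1 + \<beta> * v2 :: real"
  let ?N = "AB_law w y" and ?N' = "gamma_law (w + y) \<Otimes>\<^sub>M AB_law w y"
  note pos = \<open>w > 0\<close> \<open>y > 0\<close> and [simp] = \<open>a = w + y\<close> \<open>b = w + y\<close>
  have pos_add: "w + y > 0" using pos by simp
  interpret g: affine_recursion ?N' "\<lambda>c. fst (snd c)" "\<lambda>c. snd (snd c) * fst c" ?\<Psi>
    using pos by (rule affine_recursion_gamma)
  interpret b: affine_recursion ?N "\<lambda>c. fst c - snd c" snd ?\<Phi>
    using pos by (rule affine_recursion_beta)
  note sol_g = solves_random_eq_gamma[OF pos] and sol_b = solves_random_eq_beta[OF pos]
  have \<Phi>: "(\<lambda>(x, c). ?\<Phi> c x) \<in> borel_measurable (borel \<Otimes>\<^sub>M borel)"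
    and \<Psi>: "(\<lambda>(x, c). ?\<Psi> c x) \<in> borel_measurable (borel \<Otimes>\<^sub>M borel)"
    by (simp_all add: borel_prod [symmetric] case_prod_beta)
  have "unique_solution ?\<Psi> ?N' (gamma_law (w + y))"
    using sol_g g.solves_random_eq_unique by (auto simp: unique_solution_def)
  moreover have "unique_solution ?\<Phi> ?N (beta_law (w + y) (w + y))"
    using sol_b b.solves_random_eq_unique by (auto simp: unique_solution_def)
  moreover have "(\<exists>Y \<in> borel_measurable M. distr M borel Y = beta_law (w + y) (w + y) \<and>
      (AE \<omega> in M. uniform_limit {0..1} (\<lambda>n. backward_iter (F \<omega>) n) (\<lambda>x. Y \<omega>) sequentially)) \<and>
    (\<forall>x \<in> {0..1}. weak_conv_m (\<lambda>n. distr M borel (\<lambda>\<omega>. forward_iter (F \<omega>) n x)) (beta_law (w + y) (w + y))) \<and>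
    (\<forall>x' \<in> {0<..}. weak_conv_m (\<lambda>n. distr M borel (\<lambda>\<omega>. forward_iter (G \<omega>) n x')) (gamma_law (w + y)))"
    if iid: "iid_with_law M (\<lambda>n \<omega>. ((A n \<omega>, B n \<omega>), V n \<omega>)) {1..} (?N \<Otimes>\<^sub>M gamma_law (w + y))"
  proof (intro conjI ballI)
    have "fst \<in> (borel :: ((real \<times> real) \<times> real) measure) \<rightarrow>\<^sub>M borel"
      by (simp add: borel_prod [symmetric])
    \<comment> \<open>Projecting away \<open>V\<close> leaves the sequence that drives
      \<open>F\<close>; the swap further down arranges the one that drives \<open>G\<close>.\<close>
    from iid_with_law_compose[OF iid this]
    have iid_F: "iid_with_law M (\<lambda>n \<omega>. (A n \<omega>, B n \<omega>)) {1..} ?N"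
      by (simp only: fst_conv distr_AB_gamma_fst[OF prob_space_gamma_law[OF pos_add]])
    have "(\<lambda>(c, v). (v, c)) \<in> (borel :: ((real \<times> real) \<times> real) measure) \<rightarrow>\<^sub>M borel"
      by (simp add: borel_prod [symmetric])
    from iid_with_law_compose[OF iid this]
    have iid_G: "iid_with_law M (\<lambda>n \<omega>. (V n \<omega>, (A n \<omega>, B n \<omega>))) {1..} ?N'"
      by (simp only: prod.case distr_AB_gamma_swap[OF pos])
    show "\<exists>Y \<in> borel_measurable M. distr M borel Y = beta_law (w + y) (w + y) \<and>
      (AE \<omega> in M. uniform_limit {0..1} (\<lambda>n. backward_iter (F \<omega>) n) (\<lambda>x. Y \<omega>) sequentially)"
      unfolding F_def by (rule backward_iter_beta[OF pos iid_F])
    show "weak_conv_m (\<lambda>n. distr M borel (\<lambda>\<omega>. forward_iter (F \<omega>) n x)) (beta_law (w + y) (w + y))" for x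
      using b.weak_conv_random_step_funpow[OF sol_b integrable_beta_law[OF pos_add pos_add], of x]
        distr_forward_iter[OF iid_F \<Phi>, of _ x] by (simp add: F_def)
    show "weak_conv_m (\<lambda>n. distr M borel (\<lambda>\<omega>. forward_iter (G \<omega>) n x')) (gamma_law (w + y))" for x'
      using g.weak_conv_random_step_funpow[OF sol_g integrable_gamma_law[OF pos_add], of x']
        distr_forward_iter[OF iid_G \<Psi>, of _ x'] by (simp add: G_def)
  qed
  ultimately show ?thesis
    by simp
qed

end
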